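(* Let $S$ denote the unilateral shift. Then $T=\bigoplus_{i=1}^{\infty}(S\oplus S^* )$ is a complex symmetric operator which is not unitarily equivalent to a truncated Toeplitz operator with continuous symbol; that is, there are no nonconstant inner function $u$ and $\varphi\in C(\mathbb{T})$ such that $T$ is unitarily equivalent to $A_\varphi^u$.
   Context: The unilateral shift $S$ is the operator of multiplication by $z$ on the classical Hardy space $H^2$ (equivalently, the forward shift on $\ell^2(\mathbb{N})$). A bounded operator $T$ on a Hilbert space $\mathcal{H}$ is called complex symmetric if there is a conjugate-linear, isometric involution $J$ on $\mathcal{H}$ with $T=JT^*J$. $\mathbb{T}$ is the unit circle, and $H^2$ is viewed as a subspace of $L^2=L^2(\mathbb{T})$. For a nonconstant inner function $u$, $\mathcal{K}_u:=H^2\ominus uH^2$, $P_u$ is the orthogonal projection of $L^2$ onto $\mathcal{K}_u$, and for $\varphi\in L^\infty(\mathbb{T})$ the truncated Toeplitz operator with symbol $\varphi$ is $A_\varphi^u:\mathcal{K}_u\to\mathcal{K}_u$, $A_\varphi^u f=P_u(\varphi f)$. *)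

theory Defs
  imports "HOL-Analysis.Analysis"
begin
text \<open>
  The sesquilinear form is linear in its first argument. Its real part is the form \<open>inner\<close>
  of the underlying real inner product space, which is the one that determines the norm.
\<close>

class complex_inner = real_inner +
  fixes scaleC :: "complex \<Rightarrow> 'a \<Rightarrow> 'a" (infixr "*\<^sub>C" 75)
    and cinner :: "'a \<Rightarrow> 'a \<Rightarrow> complex"
  assumes scaleC_add_right: "c *\<^sub>C (x + y) = c *\<^sub>C x + c *\<^sub>C y"
    and scaleC_add_left: "(c + d) *\<^sub>C x = c *\<^sub>C x + d *\<^sub>C x"
    and scaleC_scaleC: "c *\<^sub>C d *\<^sub>C x = (c * d) *\<^sub>C x"
    and scaleC_of_real: "complex_of_real r *\<^sub>C x = r *\<^sub>R x"
    and cinner_add_left: "cinner (x + y) z = cinner x z + cinner y z"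
    and cinner_scaleC_left: "cinner (c *\<^sub>C x) y = c * cinner x y"
    and cinner_commute: "cinner y x = cnj (cinner x y)"
    and Re_cinner: "Re (cinner x y) = inner x y"

class chilbert_space = complex_inner + complete_space

definition clinear :: "('a::complex_inner \<Rightarrow> 'b::complex_inner) \<Rightarrow> bool" where
  "clinear A \<longleftrightarrow> (\<forall>x y. A (x + y) = A x + A y) \<and> (\<forall>c x. A (c *\<^sub>C x) = c *\<^sub>C A x)"

definition conj_linear :: "('a::complex_inner \<Rightarrow> 'b::complex_inner) \<Rightarrow> bool" where
  "conj_linear J \<longleftrightarrow>
     (\<forall>x y. J (x + y) = J x + J y) \<and> (\<forall>c x. J (c *\<^sub>C x) = cnj c *\<^sub>C J x)"

definition bounded_clinear :: "('a::complex_inner \<Rightarrow> 'b::complex_inner) \<Rightarrow> bool" where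
  "bounded_clinear A \<longleftrightarrow> clinear A \<and> (\<exists>K. \<forall>x. norm (A x) \<le> K * norm x)"

text \<open>For a bounded linear \<open>A\<close> the operator \<open>B\<close> exists and is unique.\<close>

definition cadjoint :: "('a::chilbert_space \<Rightarrow> 'a) \<Rightarrow> 'a \<Rightarrow> 'a" where
  "cadjoint A = (THE B. \<forall>x y. cinner (A x) y = cinner x (B y))"

definition conjugation :: "('a::chilbert_space \<Rightarrow> 'a) \<Rightarrow> bool" where
  "conjugation J \<longleftrightarrow> conj_linear J \<and> (\<forall>x. norm (J x) = norm x) \<and> (\<forall>x. J (J x) = x)"

definition complex_symmetric :: "('a::chilbert_space \<Rightarrow> 'a) \<Rightarrow> bool" where
  "complex_symmetric T \<longleftrightarrow>
     bounded_clinear T \<and> (\<exists>J. conjugation J \<and> T = J \<circ> cadjoint T \<circ> J)"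

text \<open>If \<open>M\<close> is a closed subspace, the vector \<open>p\<close> exists and is unique.\<close>

definition orth_proj :: "'a::chilbert_space set \<Rightarrow> 'a \<Rightarrow> 'a" where
  "orth_proj M f = (THE p. p \<in> M \<and> (\<forall>g\<in>M. cinner (f - p) g = 0))"

text \<open>
  The second operator acts on the Hilbert space \<open>M\<close>, a closed subspace of the type \<open>'b\<close>;
  its values outside \<open>M\<close> are irrelevant.
\<close>

definition unitarily_equivalent_on ::
    "('a::chilbert_space \<Rightarrow> 'a) \<Rightarrow> 'b::chilbert_space set \<Rightarrow> ('b \<Rightarrow> 'b) \<Rightarrow> bool" where
  "unitarily_equivalent_on T M A \<longleftrightarrow>
     (\<exists>U. clinear U \<and> (\<forall>x y. cinner (U x) (U y) = cinner x y) \<and> range U = M \<and>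
          (\<forall>x. U (T x) = A (U x)))"

instantiation complex :: chilbert_space
begin
definition scaleC_complex :: "complex \<Rightarrow> complex \<Rightarrow> complex" where
  "scaleC_complex c x = c * x"
definition cinner_complex :: "complex \<Rightarrow> complex \<Rightarrow> complex" where
  "cinner_complex x y = x * cnj y"
instance
  by standard (auto simp: scaleC_complex_def cinner_complex_def inner_complex_def
      algebra_simps scaleR_conv_of_real)
end

instantiation prod :: (complex_inner, complex_inner) complex_inner
begin
definition scaleC_prod :: "complex \<Rightarrow> 'a \<times> 'b \<Rightarrow> 'a \<times> 'b" where
  "scaleC_prod c x = (c *\<^sub>C fst x, c *\<^sub>C snd x)"
definition cinner_prod :: "'a \<times> 'b \<Rightarrow> 'a \<times> 'b \<Rightarrow> complex" where
  "cinner_prod x y = cinner (fst x) (fst y) + cinner (snd x) (snd y)"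
instance
proof
  fix x y :: "'a \<times> 'b"
  show "cinner y x = cnj (cinner x y)"
    unfolding cinner_prod_def by (simp add: cinner_commute[symmetric])
qed (auto simp: scaleC_prod_def cinner_prod_def inner_prod_def scaleC_add_right scaleC_add_left
      scaleC_scaleC scaleC_of_real cinner_add_left cinner_scaleC_left Re_cinner algebra_simps
      prod_eq_iff)
end

instance prod :: (chilbert_space, chilbert_space) chilbert_space ..

lemma Im_cinner: "Im (cinner x y) = - inner (\<i> *\<^sub>C x) (y :: 'a::complex_inner)"
  by (simp add: Re_cinner[symmetric] cinner_scaleC_left)

lemma cinner_self: "cinner x x = of_real ((norm (x :: 'a::complex_inner))\<^sup>2)"
proof -
  have "Im (cinner x x) = 0"
    using arg_cong[OF cinner_commute[of x x], of Im] by simp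
  then show ?thesis
    by (simp add: complex_eq_iff Re_cinner power2_norm_eq_inner)
qed

lemma norm_scaleC: "norm (c *\<^sub>C x) = norm c * norm (x :: 'a::complex_inner)"
proof -
  have "cinner (c *\<^sub>C x) (c *\<^sub>C x) = c * cnj c * cinner x x"
    by (metis (no_types, lifting) cinner_commute cinner_scaleC_left complex_cnj_cnj
        complex_cnj_mult mult.assoc)
  then have "(norm (c *\<^sub>C x))\<^sup>2 = (norm c * norm x)\<^sup>2"
    unfolding cinner_self complex_norm_square[symmetric] of_real_mult[symmetric] of_real_eq_iff
    by (simp add: power_mult_distrib)
  then show ?thesis by simp
qed

lemma norm_cinner_le: "norm (cinner x y) \<le> (norm x)\<^sup>2 + (norm (y :: 'a::complex_inner))\<^sup>2"
proof -
  have "norm (cinner x y) \<le> \<bar>Re (cinner x y)\<bar> + \<bar>Im (cinner x y)\<bar>"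
    by (rule cmod_le)
  also have "\<dots> \<le> norm x * norm y + norm x * norm y"
    using Cauchy_Schwarz_ineq2[of x y] Cauchy_Schwarz_ineq2[of "\<i> *\<^sub>C x" y]
    by (simp add: Re_cinner Im_cinner norm_scaleC)
  also have "\<dots> \<le> (norm x)\<^sup>2 + (norm y)\<^sup>2"
    using sum_squares_bound[of "norm x" "norm y"] by simp
  finally show ?thesis .
qed

typedef (overloaded) 'a l2_sum =
  "{x :: nat \<Rightarrow> 'a::real_normed_vector. summable (\<lambda>i. (norm (x i))\<^sup>2)}"
  morphisms component Abs_l2_sum
  by (rule exI[of _ "\<lambda>_. 0"]) simp

setup_lifting type_definition_l2_sum

lemma summable_component: "summable (\<lambda>i. (norm (component x i))\<^sup>2)"
  using component[of x] by simp

lemma norm_add_sq_le: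
  "(norm (x + y))\<^sup>2 \<le> 2 * (norm x)\<^sup>2 + 2 * (norm (y :: 'a::real_normed_vector))\<^sup>2"
proof -
  have "(norm (x + y))\<^sup>2 \<le> (norm x + norm y)\<^sup>2"
    by (intro power_mono norm_triangle_ineq) auto
  also have "\<dots> \<le> 2 * (norm x)\<^sup>2 + 2 * (norm y)\<^sup>2"
    using sum_squares_bound[of "norm x" "norm y"] by (simp add: power2_sum)
  finally show ?thesis .
qed

lemma abs_inner_le: "\<bar>inner x y\<bar> \<le> (norm x)\<^sup>2 + (norm (y :: 'a::real_inner))\<^sup>2"
proof -
  have "\<bar>inner x y\<bar> \<le> norm x * norm y" by (rule Cauchy_Schwarz_ineq2)
  also have "\<dots> \<le> 2 * norm x * norm y" by simp
  also have "\<dots> \<le> (norm x)\<^sup>2 + (norm y)\<^sup>2"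
    by (rule sum_squares_bound)
  finally show ?thesis .
qed

lemma summable_sq_add:
  fixes x y :: "nat \<Rightarrow> 'a::real_normed_vector"
  assumes "summable (\<lambda>i. (norm (x i))\<^sup>2)" "summable (\<lambda>i. (norm (y i))\<^sup>2)"
  shows "summable (\<lambda>i. (norm (x i + y i))\<^sup>2)"
proof (rule summable_comparison_test')
  show "summable (\<lambda>i. 2 * (norm (x i))\<^sup>2 + 2 * (norm (y i))\<^sup>2)"
    by (intro summable_add summable_mult assms)
  show "norm ((norm (x i + y i))\<^sup>2) \<le> 2 * (norm (x i))\<^sup>2 + 2 * (norm (y i))\<^sup>2" if "i \<ge> 0" for i
    using norm_add_sq_le[of "x i" "y i"] by simp
qed

lemma summable_inner_component:
  "summable (\<lambda>i. inner (component x i) (component y i))" for x y :: "'a::real_inner l2_sum"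
proof (rule summable_comparison_test')
  show "summable (\<lambda>i. (norm (component x i))\<^sup>2 + (norm (component y i))\<^sup>2)"
    by (intro summable_add summable_component)
qed (use abs_inner_le in auto)

lemma summable_cinner_component:
  "summable (\<lambda>i. cinner (component x i) (component y i))" for x y :: "'a::complex_inner l2_sum"
proof (rule summable_comparison_test')
  show "summable (\<lambda>i. (norm (component x i))\<^sup>2 + (norm (component y i))\<^sup>2)"
    by (intro summable_add summable_component)
qed (use norm_cinner_le in auto)

instantiation l2_sum :: (real_inner) real_inner
begin

lift_definition zero_l2_sum :: "'a l2_sum" is "\<lambda>i. 0" by simp
lift_definition plus_l2_sum :: "'a l2_sum \<Rightarrow> 'a l2_sum \<Rightarrow> 'a l2_sum" is "\<lambda>x y i. x i + y i"
  by (rule summable_sq_add)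
lift_definition uminus_l2_sum :: "'a l2_sum \<Rightarrow> 'a l2_sum" is "\<lambda>x i. - x i" by simp
lift_definition minus_l2_sum :: "'a l2_sum \<Rightarrow> 'a l2_sum \<Rightarrow> 'a l2_sum" is "\<lambda>x y i. x i - y i"
proof -
  fix x y :: "nat \<Rightarrow> 'a"
  assume "summable (\<lambda>i. (norm (x i))\<^sup>2)" "summable (\<lambda>i. (norm (y i))\<^sup>2)"
  then show "summable (\<lambda>i. (norm (x i - y i))\<^sup>2)"
    using summable_sq_add[of x "\<lambda>i. - y i"] by simp
qed
lift_definition scaleR_l2_sum :: "real \<Rightarrow> 'a l2_sum \<Rightarrow> 'a l2_sum" is "\<lambda>r x i. r *\<^sub>R x i"
  by (simp add: power_mult_distrib summable_mult)
definition inner_l2_sum :: "'a l2_sum \<Rightarrow> 'a l2_sum \<Rightarrow> real" where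
  "inner_l2_sum x y = (\<Sum>i. inner (component x i) (component y i))"
definition norm_l2_sum :: "'a l2_sum \<Rightarrow> real" where
  "norm_l2_sum x = sqrt (inner x x)"
definition sgn_l2_sum :: "'a l2_sum \<Rightarrow> 'a l2_sum" where
  "sgn_l2_sum x = inverse (norm x) *\<^sub>R x"
definition dist_l2_sum :: "'a l2_sum \<Rightarrow> 'a l2_sum \<Rightarrow> real" where
  "dist_l2_sum x y = norm (x - y)"
definition uniformity_l2_sum :: "('a l2_sum \<times> 'a l2_sum) filter" where
  "uniformity_l2_sum = (INF e\<in>{0<..}. principal {(x, y). dist x y < e})"
definition open_l2_sum :: "'a l2_sum set \<Rightarrow> bool" where
  "open_l2_sum U = (\<forall>x\<in>U. eventually (\<lambda>(x', y). x' = x \<longrightarrow> y \<in> U) uniformity)"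

instance
proof
  fix x y z :: "'a l2_sum" and r s :: real
  show "x + y + z = x + (y + z)" by transfer (simp add: algebra_simps)
  show "x + y = y + x" by transfer (simp add: algebra_simps)
  show "0 + x = x" by transfer simp
  show "- x + x = 0" by transfer simp
  show "x - y = x + - y" by transfer simp
  show "r *\<^sub>R (x + y) = r *\<^sub>R x + r *\<^sub>R y" by transfer (simp add: algebra_simps)
  show "(r + s) *\<^sub>R x = r *\<^sub>R x + s *\<^sub>R x" by transfer (simp add: algebra_simps)
  show "r *\<^sub>R s *\<^sub>R x = (r * s) *\<^sub>R x" by transfer simp
  show "1 *\<^sub>R x = x" by transfer simp
  show "inner x y = inner y x"
    by (simp add: inner_l2_sum_def inner_commute)
  show "inner (x + y) z = inner x z + inner y z"
    by (simp add: inner_l2_sum_def plus_l2_sum.rep_eq inner_add_left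
        suminf_add[OF summable_inner_component summable_inner_component])
  show "inner (r *\<^sub>R x) y = r * inner x y"
    by (simp add: inner_l2_sum_def scaleR_l2_sum.rep_eq suminf_mult[OF summable_inner_component])
  show "0 \<le> inner x x"
    unfolding inner_l2_sum_def by (rule suminf_nonneg[OF summable_inner_component]) simp
  show "inner x x = 0 \<longleftrightarrow> x = 0"
    unfolding inner_l2_sum_def
    by (subst suminf_eq_zero_iff[OF summable_inner_component])
       (auto simp: component_inject[symmetric] zero_l2_sum.rep_eq fun_eq_iff)
qed (auto simp: norm_l2_sum_def sgn_l2_sum_def dist_l2_sum_def uniformity_l2_sum_def
      open_l2_sum_def)

end

instantiation l2_sum :: (complex_inner) complex_inner
begin

lift_definition scaleC_l2_sum :: "complex \<Rightarrow> 'a l2_sum \<Rightarrow> 'a l2_sum" is "\<lambda>c x i. c *\<^sub>C x i"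
  by (simp add: norm_scaleC power_mult_distrib summable_mult)
definition cinner_l2_sum :: "'a l2_sum \<Rightarrow> 'a l2_sum \<Rightarrow> complex" where
  "cinner_l2_sum x y = (\<Sum>i. cinner (component x i) (component y i))"

instance
proof
  fix x y z :: "'a l2_sum" and c d :: complex and r :: real
  show "c *\<^sub>C (x + y) = c *\<^sub>C x + c *\<^sub>C y" by transfer (simp add: scaleC_add_right)
  show "(c + d) *\<^sub>C x = c *\<^sub>C x + d *\<^sub>C x" by transfer (simp add: scaleC_add_left)
  show "c *\<^sub>C d *\<^sub>C x = (c * d) *\<^sub>C x" by transfer (simp add: scaleC_scaleC)
  show "complex_of_real r *\<^sub>C x = r *\<^sub>R x" by transfer (simp add: scaleC_of_real)
  show "cinner (x + y) z = cinner x z + cinner y z"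
    by (simp add: cinner_l2_sum_def plus_l2_sum.rep_eq cinner_add_left
        suminf_add[OF summable_cinner_component summable_cinner_component])
  show "cinner (c *\<^sub>C x) y = c * cinner x y"
    by (simp add: cinner_l2_sum_def scaleC_l2_sum.rep_eq cinner_scaleC_left
        suminf_mult[OF summable_cinner_component])
  show "cinner y x = cnj (cinner x y)"
    unfolding cinner_l2_sum_def
    using bounded_linear.suminf[OF bounded_linear_cnj summable_cinner_component[of x y]]
    by (simp add: cinner_commute[symmetric])
  show "Re (cinner x y) = inner x y"
    unfolding cinner_l2_sum_def inner_l2_sum_def
    using bounded_linear.suminf[OF bounded_linear_Re summable_cinner_component[of x y]]
    by (simp add: Re_cinner)
qed

end

lemma norm_sq_l2_sum: "(norm x)\<^sup>2 = (\<Sum>i. (norm (component x i))\<^sup>2)"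
  for x :: "'a::real_inner l2_sum"
  by (simp add: power2_norm_eq_inner inner_l2_sum_def)

lemma sum_component_le: "(\<Sum>i<n. (norm (component x i))\<^sup>2) \<le> (norm x)\<^sup>2"
  for x :: "'a::real_inner l2_sum"
  unfolding norm_sq_l2_sum by (rule sum_le_suminf[OF summable_component]) auto

lemma norm_component_le: "norm (component x i) \<le> norm x" for x :: "'a::real_inner l2_sum"
proof -
  have "(norm (component x i))\<^sup>2 \<le> (\<Sum>j<Suc i. (norm (component x j))\<^sup>2)"
    by (simp add: sum_nonneg)
  also have "\<dots> \<le> (norm x)\<^sup>2" by (rule sum_component_le)
  finally show ?thesis by (rule power2_le_imp_le) simp
qed

instance l2_sum :: (chilbert_space) chilbert_space
proof
  fix X :: "nat \<Rightarrow> 'a l2_sum"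
  assume X: "Cauchy X"
  have "Cauchy (\<lambda>n. component (X n) i)" for i
  proof (rule CauchyI)
    fix e :: real assume "e > 0"
    then obtain N where N: "\<And>m n. m \<ge> N \<Longrightarrow> n \<ge> N \<Longrightarrow> norm (X m - X n) < e"
      using CauchyD[OF X] by blast
    have "norm (component (X m) i - component (X n) i) < e" if "m \<ge> N" "n \<ge> N" for m n
      using N[OF that] norm_component_le[of "X m - X n" i] by (simp add: minus_l2_sum.rep_eq)
    then show "\<exists>N. \<forall>m\<ge>N. \<forall>n\<ge>N. norm (component (X m) i - component (X n) i) < e" by blast
  qed
  then have "\<exists>l. (\<lambda>n. component (X n) i) \<longlonglongrightarrow> l" for i
    by (simp add: Cauchy_convergent convergentD)
  then obtain l where l: "\<And>i. (\<lambda>n. component (X n) i) \<longlonglongrightarrow> l i" by metis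
  have bound: "(\<Sum>i<k. (norm (component (X n) i - l i))\<^sup>2) \<le> e\<^sup>2"
    if N: "\<And>m n. m \<ge> N \<Longrightarrow> n \<ge> N \<Longrightarrow> norm (X m - X n) < e" and n: "n \<ge> N" for e N n k
  proof (rule LIMSEQ_le_const2)
    show "(\<lambda>m. \<Sum>i<k. (norm (component (X n) i - component (X m) i))\<^sup>2)
            \<longlonglongrightarrow> (\<Sum>i<k. (norm (component (X n) i - l i))\<^sup>2)"
      by (intro tendsto_intros l)
    have "(\<Sum>i<k. (norm (component (X n) i - component (X m) i))\<^sup>2) \<le> e\<^sup>2" if "m \<ge> N" for m
    proof -
      have "(\<Sum>i<k. (norm (component (X n) i - component (X m) i))\<^sup>2) \<le> (norm (X n - X m))\<^sup>2"
        using sum_component_le[of "X n - X m" k] by (simp add: minus_l2_sum.rep_eq)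
      also have "\<dots> \<le> e\<^sup>2"
        using N[OF n that] by (intro power_mono) auto
      finally show ?thesis .
    qed
    then show "\<exists>M. \<forall>m\<ge>M. (\<Sum>i<k. (norm (component (X n) i - component (X m) i))\<^sup>2) \<le> e\<^sup>2"
      by blast
  qed
  have sum_diff: "summable (\<lambda>i. (norm (component (X n) i - l i))\<^sup>2)
      \<and> (\<Sum>i. (norm (component (X n) i - l i))\<^sup>2) \<le> e\<^sup>2"
    if N: "\<And>m n. m \<ge> N \<Longrightarrow> n \<ge> N \<Longrightarrow> norm (X m - X n) < e" and n: "n \<ge> N" for e N n
  proof
    show *: "summable (\<lambda>i. (norm (component (X n) i - l i))\<^sup>2)"
      by (rule bounded_imp_summable[of _ "e\<^sup>2"])
         (use bound[OF N n, of "Suc _"] in \<open>auto simp: lessThan_Suc_atMost\<close>)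
    show "(\<Sum>i. (norm (component (X n) i - l i))\<^sup>2) \<le> e\<^sup>2"
      by (rule suminf_le_const[OF *]) (rule bound[OF N n])
  qed
  obtain N0 where N0: "\<And>m n. m \<ge> N0 \<Longrightarrow> n \<ge> N0 \<Longrightarrow> norm (X m - X n) < 1"
    using CauchyD[OF X, of 1] by auto
  have "summable (\<lambda>i. (norm (l i))\<^sup>2)"
    using summable_sq_add[OF summable_component[of "X N0"],
        of "\<lambda>i. l i - component (X N0) i"] sum_diff[OF N0 order.refl]
    by (simp add: norm_minus_commute)
  then have comp: "component (Abs_l2_sum l) = l"
    by (simp add: Abs_l2_sum_inverse)
  have "X \<longlonglongrightarrow> Abs_l2_sum l"
  proof (rule LIMSEQ_I)
    fix r :: real assume "r > 0"
    then obtain N where N: "\<And>m n. m \<ge> N \<Longrightarrow> n \<ge> N \<Longrightarrow> norm (X m - X n) < r / 2"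
      using CauchyD[OF X, of "r / 2"] by auto
    have "norm (X n - Abs_l2_sum l) < r" if "n \<ge> N" for n
    proof -
      have "(norm (X n - Abs_l2_sum l))\<^sup>2 \<le> (r / 2)\<^sup>2"
        using sum_diff[OF N that] by (simp add: norm_sq_l2_sum minus_l2_sum.rep_eq comp)
      then have "norm (X n - Abs_l2_sum l) \<le> r / 2"
        by (rule power2_le_imp_le) (use \<open>r > 0\<close> in simp)
      then show ?thesis using \<open>r > 0\<close> by simp
    qed
    then show "\<exists>no. \<forall>n\<ge>no. norm (X n - Abs_l2_sum l) < r" by blast
  qed
  then show "convergent X" by (rule convergentI)
qed

text \<open>Meaningful for uniformly bounded families of linear operators.\<close>

definition direct_sum ::
    "(nat \<Rightarrow> 'a::real_normed_vector \<Rightarrow> 'a) \<Rightarrow> 'a l2_sum \<Rightarrow> 'a l2_sum" where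
  "direct_sum A x = Abs_l2_sum (\<lambda>i. A i (component x i))"

type_synonym ell2 = "complex l2_sum"

lift_definition unilateral_shift :: "ell2 \<Rightarrow> ell2" is "\<lambda>x. case_nat 0 x"
  by (subst summable_Suc_iff[symmetric]) simp

text \<open>
  Normalized arc length measure. Its underlying space is the circle, so functions on the
  complex plane only matter through their values there.
\<close>

definition circ :: "complex measure" where
  "circ = distr (uniform_measure lborel {0..<2 * pi}) (restrict_space borel (sphere 0 1)) cis"

definition square_integrable :: "(complex \<Rightarrow> complex) \<Rightarrow> bool" where
  "square_integrable f \<longleftrightarrow> f \<in> borel_measurable circ \<and> integrable circ (\<lambda>z. (norm (f z))\<^sup>2)"

lemma square_integrable_zero: "square_integrable (\<lambda>_. 0)"
  by (simp add: square_integrable_def)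

definition L2_rel :: "(complex \<Rightarrow> complex) \<Rightarrow> (complex \<Rightarrow> complex) \<Rightarrow> bool" where
  "L2_rel f g \<longleftrightarrow> square_integrable f \<and> square_integrable g \<and> (AE z in circ. f z = g z)"

lemma part_equivp_L2_rel: "part_equivp L2_rel"
proof (rule part_equivpI)
  show "\<exists>f. L2_rel f f"
    using square_integrable_zero by (auto simp: L2_rel_def)
  show "symp L2_rel"
    by (auto simp: symp_def L2_rel_def elim: eventually_mono)
  show "transp L2_rel"
    unfolding transp_def L2_rel_def by (auto elim: eventually_elim2)
qed

quotient_type L2 = "complex \<Rightarrow> complex" / partial: L2_rel
  by (rule part_equivp_L2_rel)

lemma square_integrable_add:
  assumes f: "square_integrable f" and g: "square_integrable g"
  shows "square_integrable (\<lambda>z. f z + g z)"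
proof -
  have [measurable]: "f \<in> borel_measurable circ" "g \<in> borel_measurable circ"
    using f g by (auto simp: square_integrable_def)
  have "integrable circ (\<lambda>z. (norm (f z + g z))\<^sup>2)"
  proof (rule Bochner_Integration.integrable_bound)
    show "integrable circ (\<lambda>z. 2 * (norm (f z))\<^sup>2 + 2 * (norm (g z))\<^sup>2)"
      using f g by (auto simp: square_integrable_def)
    show "AE z in circ. norm ((norm (f z + g z))\<^sup>2) \<le> norm (2 * (norm (f z))\<^sup>2 + 2 * (norm (g z))\<^sup>2)"
      by (rule AE_I2) (use norm_add_sq_le in force)
  qed simp
  then show ?thesis by (simp add: square_integrable_def)
qed

lemma square_integrable_mult:
  "square_integrable f \<Longrightarrow> square_integrable (\<lambda>z. c * f z)"
  by (auto simp: square_integrable_def norm_mult power_mult_distrib)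

lemma square_integrable_uminus:
  "square_integrable f \<Longrightarrow> square_integrable (\<lambda>z. - f z)"
  using square_integrable_mult[of f "-1"] by simp

lemma square_integrable_diff:
  "square_integrable f \<Longrightarrow> square_integrable g \<Longrightarrow> square_integrable (\<lambda>z. f z - g z)"
  using square_integrable_add[of f "\<lambda>z. - g z"] by (simp add: square_integrable_uminus)

lemma square_integrable_scaleR:
  "square_integrable f \<Longrightarrow> square_integrable (\<lambda>z. r *\<^sub>R f z)"
  using square_integrable_mult[of f "of_real r"] by (simp add: scaleR_conv_of_real)

lemma borel_measurable_cnj [measurable]:
  "f \<in> borel_measurable M \<Longrightarrow> (\<lambda>z. cnj (f z)) \<in> borel_measurable M"
  by (rule borel_measurable_continuous_on[OF continuous_on_cnj[OF continuous_on_id]])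

lemma integrable_cinner_L2:
  assumes f: "square_integrable f" and g: "square_integrable g"
  shows "integrable circ (\<lambda>z. cinner (f z) (g z))"
proof (rule Bochner_Integration.integrable_bound)
  show "integrable circ (\<lambda>z. (norm (f z))\<^sup>2 + (norm (g z))\<^sup>2)"
    using f g by (auto simp: square_integrable_def)
  show "AE z in circ. norm (cinner (f z) (g z)) \<le> norm ((norm (f z))\<^sup>2 + (norm (g z))\<^sup>2)"
    by (rule AE_I2) (use norm_cinner_le in force)
  have [measurable]: "f \<in> borel_measurable circ" "g \<in> borel_measurable circ"
    using f g by (auto simp: square_integrable_def)
  show "(\<lambda>z. cinner (f z) (g z)) \<in> borel_measurable circ"
    unfolding cinner_complex_def by measurable
qed

lemma integrable_inner_L2:
  assumes f: "square_integrable f" and g: "square_integrable g"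
  shows "integrable circ (\<lambda>z. inner (f z) (g z))"
  using integrable_Re[OF integrable_cinner_L2[OF assms]] by (simp add: Re_cinner)

instantiation L2 :: real_inner
begin

lift_definition zero_L2 :: L2 is "\<lambda>z. 0"
  by (simp add: L2_rel_def square_integrable_zero)
lift_definition plus_L2 :: "L2 \<Rightarrow> L2 \<Rightarrow> L2" is "\<lambda>f g z. f z + g z"
  by (auto simp: L2_rel_def square_integrable_add elim: eventually_elim2)
lift_definition uminus_L2 :: "L2 \<Rightarrow> L2" is "\<lambda>f z. - f z"
  by (auto simp: L2_rel_def square_integrable_uminus)
lift_definition minus_L2 :: "L2 \<Rightarrow> L2 \<Rightarrow> L2" is "\<lambda>f g z. f z - g z"
  by (auto simp: L2_rel_def square_integrable_diff elim: eventually_elim2)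
lift_definition scaleR_L2 :: "real \<Rightarrow> L2 \<Rightarrow> L2" is "\<lambda>r f z. r *\<^sub>R f z"
  unfolding L2_rel_def by (auto intro!: square_integrable_scaleR elim: eventually_mono)
lift_definition inner_L2 :: "L2 \<Rightarrow> L2 \<Rightarrow> real" is "\<lambda>f g. \<integral>z. inner (f z) (g z) \<partial>circ"
proof -
  fix f f' g g' :: "complex \<Rightarrow> complex"
  assume *: "L2_rel f f'" "L2_rel g g'"
  have [measurable]: "f \<in> borel_measurable circ" "f' \<in> borel_measurable circ"
      "g \<in> borel_measurable circ" "g' \<in> borel_measurable circ"
    using * by (auto simp: L2_rel_def square_integrable_def)
  show "(\<integral>z. inner (f z) (g z) \<partial>circ) = (\<integral>z. inner (f' z) (g' z) \<partial>circ)"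
    by (rule integral_cong_AE) (use * in \<open>auto simp: L2_rel_def elim: eventually_elim2\<close>)
qed
definition norm_L2 :: "L2 \<Rightarrow> real" where
  "norm_L2 f = sqrt (inner f f)"
definition sgn_L2 :: "L2 \<Rightarrow> L2" where
  "sgn_L2 f = inverse (norm f) *\<^sub>R f"
definition dist_L2 :: "L2 \<Rightarrow> L2 \<Rightarrow> real" where
  "dist_L2 f g = norm (f - g)"
definition uniformity_L2 :: "(L2 \<times> L2) filter" where
  "uniformity_L2 = (INF e\<in>{0<..}. principal {(f, g). dist f g < e})"
definition open_L2 :: "L2 set \<Rightarrow> bool" where
  "open_L2 U = (\<forall>f\<in>U. eventually (\<lambda>(f', g). f' = f \<longrightarrow> g \<in> U) uniformity)"

instance
proof
  fix f g h :: L2 and r s :: real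
  show "f + g + h = f + (g + h)"
    by transfer (auto simp: L2_rel_def algebra_simps intro!: square_integrable_add)
  show "f + g = g + f"
    by transfer (auto simp: L2_rel_def algebra_simps intro!: square_integrable_add)
  show "0 + f = f"
    by transfer (auto simp: L2_rel_def)
  show "- f + f = 0"
    by transfer (auto simp: L2_rel_def square_integrable_zero)
  show "f - g = f + - g"
    by transfer (auto simp: L2_rel_def intro!: square_integrable_diff)
  show "r *\<^sub>R (f + g) = r *\<^sub>R f + r *\<^sub>R g"
    by transfer (auto simp: L2_rel_def scaleR_add_right
        intro!: square_integrable_add square_integrable_scaleR)
  show "(r + s) *\<^sub>R f = r *\<^sub>R f + s *\<^sub>R f"
    by transfer (auto simp: L2_rel_def scaleR_add_left
        intro!: square_integrable_add square_integrable_scaleR)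
  show "r *\<^sub>R s *\<^sub>R f = (r * s) *\<^sub>R f"
    by transfer (auto simp: L2_rel_def intro!: square_integrable_scaleR)
  show "1 *\<^sub>R f = f"
    by transfer (auto simp: L2_rel_def)
  show "inner f g = inner g f"
    by transfer (simp add: inner_commute)
  show "inner (f + g) h = inner f h + inner g h"
    by transfer (simp add: inner_add_left L2_rel_def integrable_inner_L2)
  show "inner (r *\<^sub>R f) g = r * inner f g"
    by transfer (simp add: L2_rel_def integrable_inner_L2)
  show "0 \<le> inner f f"
    by transfer simp
  show "inner f f = 0 \<longleftrightarrow> f = 0"
  proof transfer
    fix f assume "L2_rel f f"
    then have f: "square_integrable f" by (simp add: L2_rel_def)
    have "(\<integral>z. inner (f z) (f z) \<partial>circ) = 0 \<longleftrightarrow> (AE z in circ. inner (f z) (f z) = 0)"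
      by (rule integral_nonneg_eq_0_iff_AE[OF integrable_inner_L2[OF f f]]) simp
    then show "(\<integral>z. inner (f z) (f z) \<partial>circ) = 0 \<longleftrightarrow> L2_rel f (\<lambda>z. 0)"
      by (simp add: L2_rel_def f square_integrable_zero)
  qed
qed (auto simp: norm_L2_def sgn_L2_def dist_L2_def uniformity_L2_def open_L2_def)

end

instantiation L2 :: complex_inner
begin

lift_definition scaleC_L2 :: "complex \<Rightarrow> L2 \<Rightarrow> L2" is "\<lambda>c f z. c * f z"
  unfolding L2_rel_def by (auto intro!: square_integrable_mult elim: eventually_mono)
lift_definition cinner_L2 :: "L2 \<Rightarrow> L2 \<Rightarrow> complex" is "\<lambda>f g. \<integral>z. f z * cnj (g z) \<partial>circ"
proof -
  fix f f' g g' :: "complex \<Rightarrow> complex"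
  assume *: "L2_rel f f'" "L2_rel g g'"
  have [measurable]: "f \<in> borel_measurable circ" "f' \<in> borel_measurable circ"
      "g \<in> borel_measurable circ" "g' \<in> borel_measurable circ"
    using * by (auto simp: L2_rel_def square_integrable_def)
  show "(\<integral>z. f z * cnj (g z) \<partial>circ) = (\<integral>z. f' z * cnj (g' z) \<partial>circ)"
    by (rule integral_cong_AE) (use * in \<open>auto simp: L2_rel_def elim: eventually_elim2\<close>)
qed

instance
proof
  fix f g h :: L2 and c d :: complex and r :: real
  note int = integrable_cinner_L2[unfolded cinner_complex_def]
  show "c *\<^sub>C (f + g) = c *\<^sub>C f + c *\<^sub>C g"
    by transfer (auto simp: L2_rel_def distrib_left
        intro!: square_integrable_add square_integrable_mult)
  show "(c + d) *\<^sub>C f = c *\<^sub>C f + d *\<^sub>C f"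
    by transfer (auto simp: L2_rel_def distrib_right
        intro!: square_integrable_add square_integrable_mult)
  show "c *\<^sub>C d *\<^sub>C f = (c * d) *\<^sub>C f"
    by transfer (auto simp: L2_rel_def mult.assoc intro!: square_integrable_mult)
  show "complex_of_real r *\<^sub>C f = r *\<^sub>R f"
    by transfer (auto simp: L2_rel_def scaleR_conv_of_real intro!: square_integrable_mult)
  show "cinner (f + g) h = cinner f h + cinner g h"
    by transfer (simp add: distrib_right L2_rel_def int)
  show "cinner (c *\<^sub>C f) g = c * cinner f g"
    by transfer (simp add: L2_rel_def mult.assoc)
  show "cinner g f = cnj (cinner f g)"
    by transfer (simp add: Bochner_Integration.integral_cnj[symmetric] mult.commute del: Bochner_Integration.integral_cnj)
  show "Re (cinner f g) = inner f g"
    by transfer (simp add: L2_rel_def int integral_Re[symmetric] inner_complex_def)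
qed

end

lemma L2_cases:
  obtains f where "square_integrable f" "x = abs_L2 f"
proof -
  have "L2_rel (rep_L2 x) (rep_L2 x)" "abs_L2 (rep_L2 x) = x"
    using Quotient3_rep_reflp[OF Quotient3_L2] Quotient3_abs_rep[OF Quotient3_L2] by auto
  then show ?thesis
    using that[of "rep_L2 x"] by (simp add: L2_rel_def)
qed

lemma diff_abs_L2:
  assumes "square_integrable f" "square_integrable g"
  shows "abs_L2 f - abs_L2 g = abs_L2 (\<lambda>z. f z - g z)"
  using assms by (intro minus_L2.abs_eq) (auto simp: L2_rel_def)

lemma norm_sq_abs_L2:
  assumes "square_integrable f"
  shows "(norm (abs_L2 f))\<^sup>2 = (\<integral>z. (norm (f z))\<^sup>2 \<partial>circ)"
  using assms inner_L2.abs_eq[of f f]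
  by (simp add: power2_norm_eq_inner L2_rel_def)

lemma nn_integral_norm_sq_L2:
  assumes "square_integrable f"
  shows "(\<integral>\<^sup>+z. ennreal ((norm (f z))\<^sup>2) \<partial>circ) = ennreal ((norm (abs_L2 f))\<^sup>2)"
  using assms by (simp add: norm_sq_abs_L2 nn_integral_eq_integral square_integrable_def)

lemma square_integrableI:
  assumes "f \<in> borel_measurable circ" "(\<integral>\<^sup>+z. ennreal ((norm (f z))\<^sup>2) \<partial>circ) \<le> ennreal c"
  shows "square_integrable f"
  using assms unfolding square_integrable_def
  by (intro conjI integrableI_bounded)
     (auto intro!: le_less_trans[OF _ ennreal_less_top])

lemma convergent_if_weighted_sum_finite:
  fixes a :: "nat \<Rightarrow> 'a::banach"
  assumes fin: "(\<Sum>k. ennreal (4 ^ k * (norm (a (Suc k) - a k))\<^sup>2)) \<noteq> \<infinity>"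
  shows "convergent a"
proof -
  define w where "w = (\<Sum>k. ennreal (4 ^ k * (norm (a (Suc k) - a k))\<^sup>2))"
  define c where "c = enn2real w"
  have wc: "w = ennreal c"
    using fin by (simp add: w_def c_def top.not_eq_extremum)
  have c: "4 ^ k * (norm (a (Suc k) - a k))\<^sup>2 \<le> c" for k
  proof -
    have "(\<Sum>k\<in>{k}. ennreal (4 ^ k * (norm (a (Suc k) - a k))\<^sup>2)) \<le> w"
      unfolding w_def by (rule sum_le_suminf) auto
    then have "ennreal (4 ^ k * (norm (a (Suc k) - a k))\<^sup>2) \<le> ennreal c"
      unfolding wc by (simp only: sum.insert_if sum.empty finite.emptyI empty_iff if_False add_0_right)
    then show ?thesis
      by (subst (asm) ennreal_le_iff) (auto simp: c_def)
  qed
  have "summable (\<lambda>k. a (Suc k) - a k)"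
  proof (rule summable_comparison_test')
    show "summable (\<lambda>k. sqrt c * (1 / 2) ^ k)"
      by (intro summable_mult summable_geometric) simp
    fix k :: nat
    have "(2 ^ k * norm (a (Suc k) - a k))\<^sup>2 = 4 ^ k * (norm (a (Suc k) - a k))\<^sup>2"
      by (simp add: power2_eq_square) (simp add: mult_ac power_mult_distrib[symmetric])
    then have "2 ^ k * norm (a (Suc k) - a k) \<le> sqrt c"
      using c[of k] by (intro real_le_rsqrt) simp
    then show "norm (a (Suc k) - a k) \<le> sqrt c * (1 / 2) ^ k"
      by (simp add: field_simps power_one_over)
  qed
  then have "convergent (\<lambda>m. \<Sum>k<m. a (Suc k) - a k)"
    by (simp add: summable_iff_convergent)
  then show "convergent a"
    by (simp add: sum_lessThan_telescope convergent_diff_const_right_iff)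
qed

instance L2 :: chilbert_space
proof
  fix X :: "nat \<Rightarrow> L2"
  assume X: "Cauchy X"
  have "\<exists>N. \<forall>m\<ge>N. \<forall>n\<ge>N. norm (X m - X n) < (1 / 4) ^ k" for k :: nat
    by (rule CauchyD[OF X]) simp
  then obtain N where N: "\<And>k m n. m \<ge> N k \<Longrightarrow> n \<ge> N k \<Longrightarrow> norm (X m - X n) < (1 / 4) ^ k"
    by metis
  define r where "r k = (\<Sum>j\<le>k. N j) + k" for k
  have r: "strict_mono r"
    by (rule strict_monoI_Suc) (simp add: r_def)
  have rN: "r k \<ge> N k" for k
    using member_le_sum[of k "{..k}" N] by (simp add: r_def)
  have "\<exists>f. \<forall>k. square_integrable (f k) \<and> X (r k) = abs_L2 (f k)"
    by (intro choice allI) (metis L2_cases)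
  then obtain g where g: "\<And>k. square_integrable (g k)" and Xg: "\<And>k. X (r k) = abs_L2 (g k)"
    by blast
  have gd: "square_integrable (\<lambda>z. g m z - g n z)" for m n
    by (intro square_integrable_diff g)
  have [measurable]: "g k \<in> borel_measurable circ" for k
    using g by (simp add: square_integrable_def)
  have bound: "(\<integral>\<^sup>+z. ennreal ((norm (g m z - g n z))\<^sup>2) \<partial>circ) \<le> ennreal (((1 / 4) ^ n)\<^sup>2)"
    if "m \<ge> n" for m n
  proof -
    have "r m \<ge> N n"
      using rN[of n] strict_mono_leD[OF r that] by simp
    then have "norm (X (r m) - X (r n)) \<le> (1 / 4) ^ n"
      using N[of n "r m" "r n"] rN[of n] by simp
    then have "(norm (X (r m) - X (r n)))\<^sup>2 \<le> ((1 / 4) ^ n)\<^sup>2"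
      by (intro power_mono) auto
    then show ?thesis
      by (simp add: nn_integral_norm_sq_L2[OF gd] Xg diff_abs_L2 g ennreal_leI)
  qed
  define w where "w z = (\<Sum>k. ennreal (4 ^ k * (norm (g (Suc k) z - g k z))\<^sup>2))" for z
  have [measurable]: "w \<in> borel_measurable circ"
    unfolding w_def by measurable
  have "(\<integral>\<^sup>+z. w z \<partial>circ)
      = (\<Sum>k. \<integral>\<^sup>+z. ennreal (4 ^ k * (norm (g (Suc k) z - g k z))\<^sup>2) \<partial>circ)"
    unfolding w_def by (rule nn_integral_suminf) measurable
  also have "\<dots> \<le> (\<Sum>k. ennreal ((1 / 4) ^ k))"
  proof (rule suminf_le)
    fix k
    have "(\<integral>\<^sup>+z. ennreal (4 ^ k * (norm (g (Suc k) z - g k z))\<^sup>2) \<partial>circ)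
        = ennreal (4 ^ k) * (\<integral>\<^sup>+z. ennreal ((norm (g (Suc k) z - g k z))\<^sup>2) \<partial>circ)"
      by (subst nn_integral_cmult[symmetric]) (auto simp: ennreal_mult)
    also have "\<dots> \<le> ennreal (4 ^ k) * ennreal (((1 / 4) ^ k)\<^sup>2)"
      by (intro mult_left_mono bound) auto
    also have "\<dots> = ennreal ((1 / 4) ^ k)"
    proof -
      have "4 ^ k * ((1 / 4) ^ k)\<^sup>2 = (1 / 4 :: real) ^ k"
        by (simp add: power_one_over power2_eq_square)
      then show ?thesis
        by (metis ennreal_mult zero_le_numeral zero_le_power zero_le_power2)
    qed
    finally show "(\<integral>\<^sup>+z. ennreal (4 ^ k * (norm (g (Suc k) z - g k z))\<^sup>2) \<partial>circ)
        \<le> ennreal ((1 / 4) ^ k)" .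
  qed auto
  also have "\<dots> < \<infinity>"
    by (subst suminf_ennreal2) auto
  finally have "AE z in circ. w z \<noteq> \<infinity>"
    by (intro nn_integral_PInf_AE) auto
  then have conv: "AE z in circ. convergent (\<lambda>k. g k z)"
    by (rule eventually_mono) (use convergent_if_weighted_sum_finite in \<open>simp add: w_def\<close>)
  define f where "f z = lim (\<lambda>k. g k z)" for z
  have [measurable]: "f \<in> borel_measurable circ"
    unfolding f_def by measurable
  have fatou: "(\<integral>\<^sup>+z. ennreal ((norm (f z - g n z))\<^sup>2) \<partial>circ) \<le> ennreal (((1 / 4) ^ n)\<^sup>2)" for n
  proof -
    have "(\<integral>\<^sup>+z. ennreal ((norm (f z - g n z))\<^sup>2) \<partial>circ)
        = (\<integral>\<^sup>+z. liminf (\<lambda>m. ennreal ((norm (g m z - g n z))\<^sup>2)) \<partial>circ)"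
    proof (rule nn_integral_cong_AE, rule eventually_mono[OF conv])
      fix z assume "convergent (\<lambda>k. g k z)"
      then have "(\<lambda>m. g m z) \<longlonglongrightarrow> f z"
        by (simp add: f_def convergent_LIMSEQ_iff)
      then have "(\<lambda>m. ennreal ((norm (g m z - g n z))\<^sup>2)) \<longlonglongrightarrow> ennreal ((norm (f z - g n z))\<^sup>2)"
        by (intro tendsto_intros tendsto_ennrealI)
      then show "ennreal ((norm (f z - g n z))\<^sup>2) = liminf (\<lambda>m. ennreal ((norm (g m z - g n z))\<^sup>2))"
        by (intro lim_imp_Liminf[symmetric]) auto
    qed
    also have "\<dots> \<le> liminf (\<lambda>m. \<integral>\<^sup>+z. ennreal ((norm (g m z - g n z))\<^sup>2) \<partial>circ)"
      by (rule nn_integral_liminf) measurable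
    also have "\<dots> \<le> ennreal (((1 / 4) ^ n)\<^sup>2)"
    proof (rule order_trans[OF Liminf_le_Limsup])
      show "limsup (\<lambda>m. \<integral>\<^sup>+z. ennreal ((norm (g m z - g n z))\<^sup>2) \<partial>circ) \<le> ennreal (((1 / 4) ^ n)\<^sup>2)"
        by (rule Limsup_bounded) (use bound in \<open>auto simp: eventually_sequentially\<close>)
    qed simp
    finally show ?thesis .
  qed
  have fg: "square_integrable (\<lambda>z. f z - g n z)" for n
    by (rule square_integrableI[OF _ fatou]) measurable
  have f: "square_integrable f"
    using square_integrable_add[OF fg[of 0] g[of 0]] by simp
  have "norm (abs_L2 f - X (r n)) \<le> (1 / 4) ^ n" for n
  proof -
    have "(norm (abs_L2 f - X (r n)))\<^sup>2 \<le> ((1 / 4) ^ n)\<^sup>2"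
      using fatou[of n] by (simp add: nn_integral_norm_sq_L2[OF fg] Xg diff_abs_L2 f g)
    then show ?thesis
      by (rule power2_le_imp_le) simp
  qed
  then have "(\<lambda>n. X (r n)) \<longlonglongrightarrow> abs_L2 f"
    by (intro LIM_zero_cancel[of _ "abs_L2 f"]
        Lim_null_comparison[OF always_eventually LIMSEQ_power_zero[of "1 / 4 :: real"]])
       (auto simp: norm_minus_commute)
  then have "X \<longlonglongrightarrow> abs_L2 f"
    using Cauchy_converges_subseq[OF X r] by (simp add: o_def)
  then show "convergent X" by (rule convergentI)
qed

lift_definition fourier_coeff :: "L2 \<Rightarrow> int \<Rightarrow> complex" is
  "\<lambda>f n. \<integral>z. f z * z powi (- n) \<partial>circ"
proof -
  fix f f' :: "complex \<Rightarrow> complex"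
  assume *: "L2_rel f f'"
  have "(\<integral>z. f z * z powi (- n) \<partial>circ) = (\<integral>z. f' z * z powi (- n) \<partial>circ)" for n :: int
  proof (rule integral_cong_AE)
    have [measurable]: "f \<in> borel_measurable circ" "f' \<in> borel_measurable circ"
      using * by (auto simp: L2_rel_def square_integrable_def)
    have "(\<lambda>z::complex. z powi (- n)) \<in> borel_measurable (restrict_space borel (sphere 0 1))"
      by (intro borel_measurable_continuous_on_restrict continuous_on_power_int continuous_on_id)
         (auto simp: dist_norm)
    then have [measurable]: "(\<lambda>z. z powi (- n)) \<in> borel_measurable circ"
      by (simp add: circ_def)
    show "(\<lambda>z. f z * z powi (- n)) \<in> borel_measurable circ"
         "(\<lambda>z. f' z * z powi (- n)) \<in> borel_measurable circ"
      by measurable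
    show "AE z in circ. f z * z powi (- n) = f' z * z powi (- n)"
      using * by (auto simp: L2_rel_def elim: eventually_mono)
  qed
  then show "(\<lambda>n. \<integral>z. f z * z powi (- n) \<partial>circ) = (\<lambda>n. \<integral>z. f' z * z powi (- n) \<partial>circ)"
    by simp
qed

text \<open>The Hardy space in terms of boundary values, as a subspace of \<open>L\<^sup>2\<close> of the circle.\<close>

definition H2 :: "L2 set" where
  "H2 = {f. \<forall>n<0. fourier_coeff f n = 0}"

definition ess_bounded :: "(complex \<Rightarrow> complex) \<Rightarrow> bool" where
  "ess_bounded \<phi> \<longleftrightarrow>
     \<phi> \<in> borel_measurable circ \<and> (\<exists>C. AE z in circ. norm (\<phi> z) \<le> C)"

text \<open>
  Inner functions are given by their boundary values: they are the elements of
  \<open>H\<^sup>\<infinity> = L\<^sup>\<infinity> \<inter> H\<^sup>2\<close> that are unimodular almost everywhere on the circle.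
\<close>

definition inner_function :: "(complex \<Rightarrow> complex) \<Rightarrow> bool" where
  "inner_function u \<longleftrightarrow> ess_bounded u \<and> abs_L2 u \<in> H2 \<and> (AE z in circ. norm (u z) = 1)"

definition nonconstant :: "(complex \<Rightarrow> complex) \<Rightarrow> bool" where
  "nonconstant u \<longleftrightarrow> \<not> (\<exists>c. AE z in circ. u z = c)"

text \<open>Meaningful for \<open>\<phi>\<close> in \<open>L\<^sup>\<infinity>\<close>.\<close>

definition mult_op :: "(complex \<Rightarrow> complex) \<Rightarrow> L2 \<Rightarrow> L2" where
  "mult_op \<phi> f = abs_L2 (\<lambda>z. \<phi> z * rep_L2 f z)"

definition model_space :: "(complex \<Rightarrow> complex) \<Rightarrow> L2 set" where
  "model_space u = {f \<in> H2. \<forall>g\<in>H2. cinner f (mult_op u g) = 0}"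

definition truncated_toeplitz :: "(complex \<Rightarrow> complex) \<Rightarrow> (complex \<Rightarrow> complex) \<Rightarrow> L2 \<Rightarrow> L2" where
  "truncated_toeplitz u \<phi> f = orth_proj (model_space u) (mult_op \<phi> f)"

end

theory Submission
  imports Defs
begin

text \<open>
  For a trigonometric polynomial \<open>p\<close> and \<open>f\<close> in the model space, \<open>p f\<close> differs from
  \<open>P\<^sub>u (p f)\<close> by an expression in finitely many Fourier coefficients of \<open>f\<close> and of
  \<open>cnj u * f\<close>. So \<open>\<phi> f\<^sub>n - P\<^sub>u (\<phi> f\<^sub>n)\<close> tends to zero in norm for every weakly null
  sequence \<open>f\<^sub>n\<close> in the model space, first for polynomial and then, by uniform approximation,
  for continuous \<open>\<phi>\<close>. On the other hand \<open>T\<close> has a weakly null orthonormal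
  sequence \<open>e\<^sub>n\<close> with \<open>T e\<^sub>n = 0\<close> and unit vectors \<open>g\<^sub>n\<close> with \<open>T g\<^sub>n = e\<^sub>n\<close>. If \<open>f\<^sub>n\<close> and
  \<open>h\<^sub>n\<close> are their images in the model space, then \<open>\<phi> f\<^sub>n\<close> tends to zero, hence so does
  \<open>cnj \<phi> * f\<^sub>n\<close>, which contradicts \<open>1 = \<langle>\<phi> h\<^sub>n, f\<^sub>n\<rangle> = \<langle>h\<^sub>n, cnj \<phi> * f\<^sub>n\<rangle>\<close>.
  The conjugation \<open>(x, y) \<mapsto> (cnj y, cnj x)\<close> in each summand shows complex symmetry.
\<close>

subsection \<open>Complex inner product spaces\<close>

lemma cinner_add_right: "cinner x (y + z) = cinner x y + cinner x (z :: 'a::complex_inner)"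
  by (metis cinner_add_left cinner_commute complex_cnj_add)

lemma cinner_scaleC_right: "cinner x (c *\<^sub>C y) = cnj c * cinner x (y :: 'a::complex_inner)"
  by (metis cinner_commute cinner_scaleC_left complex_cnj_mult)

lemma cinner_diff_left: "cinner (x - y) z = cinner x z - cinner y (z :: 'a::complex_inner)"
  using cinner_add_left[of "x - y" y z] by simp

lemma cinner_diff_right: "cinner x (y - z) = cinner x y - cinner x (z :: 'a::complex_inner)"
  using cinner_add_right[of x "y - z" z] by simp

lemma cinner_zero_left [simp]: "cinner 0 x = 0" for x :: "'a::complex_inner"
  using cinner_diff_left[of x x x] by simp

lemma cinner_zero_right [simp]: "cinner x 0 = 0" for x :: "'a::complex_inner"
  using cinner_diff_right[of x x x] by simp

lemma cinner_eqI_right: "(\<And>x. cinner x y = cinner x y') \<Longrightarrow> y = (y' :: 'a::complex_inner)"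
  by (metis Re_cinner vector_eq_ldot)

text \<open>Multiplying \<open>x\<close> by the unimodular constant \<open>c\<close> makes
  \<open>cinner x y\<close> real and nonnegative, so that the real Cauchy-Schwarz inequality applies
  to it.\<close>

lemma norm_cinner_le_mult: "norm (cinner x y) \<le> norm x * norm (y :: 'a::complex_inner)"
proof (cases "cinner x y = 0")
  case False
  define c where "c = cnj (cinner x y) / norm (cinner x y)"
  have c: "norm c = 1"
    using False by (simp add: c_def norm_divide)
  have "cinner (c *\<^sub>C x) y = norm (cinner x y)"
    using False by (simp add: c_def cinner_scaleC_left complex_norm_square[symmetric] mult.commute
        power2_eq_square)
  then have "norm (cinner x y) = inner (c *\<^sub>C x) y"
    by (metis Re_cinner Re_complex_of_real)
  also have "\<dots> \<le> norm (c *\<^sub>C x) * norm y"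
    by (rule norm_cauchy_schwarz)
  finally show ?thesis
    by (simp add: norm_scaleC c)
qed simp

lemma tendsto_cinner_left:
  assumes "X \<longlonglongrightarrow> x"
  shows "(\<lambda>n. cinner (X n) y) \<longlonglongrightarrow> cinner x (y :: 'a::complex_inner)"
proof (rule LIM_zero_cancel, rule Lim_null_comparison[OF always_eventually])
  show "\<forall>n. norm (cinner (X n) y - cinner x y) \<le> norm (X n - x) * norm y"
    by (simp add: cinner_diff_left[symmetric] norm_cinner_le_mult)
  show "(\<lambda>n. norm (X n - x) * norm y) \<longlonglongrightarrow> 0"
    by (intro tendsto_mult_left_zero tendsto_norm_zero LIM_zero assms)
qed

section \<open>Orthogonal complements and the projection theorem\<close>

text \<open>Closed subspaces enter the proof only as orthogonal complements of sets. Linearity and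
  closedness are then automatic, and both \<open>H2\<close> and \<open>model_space u\<close> have
  this form.\<close>

definition orth :: "'a::complex_inner set \<Rightarrow> 'a set" where
  "orth S = {x. \<forall>y\<in>S. cinner x y = 0}"

lemma orth_zero: "0 \<in> orth S"
  by (simp add: orth_def)

lemma orth_add: "x \<in> orth S \<Longrightarrow> y \<in> orth S \<Longrightarrow> x + y \<in> orth S"
  by (simp add: orth_def cinner_add_left)

lemma orth_diff: "x \<in> orth S \<Longrightarrow> y \<in> orth S \<Longrightarrow> x - y \<in> orth S"
  by (simp add: orth_def cinner_diff_left)

lemma orth_scaleC: "x \<in> orth S \<Longrightarrow> c *\<^sub>C x \<in> orth S"
  by (simp add: orth_def cinner_scaleC_left)

lemma closed_orth:
  assumes "\<And>n. X n \<in> orth S" "X \<longlonglongrightarrow> x"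
  shows "x \<in> orth S"
proof -
  have "cinner x y = 0" if "y \<in> S" for y
  proof (rule LIMSEQ_unique)
    show "(\<lambda>n. cinner (X n) y) \<longlonglongrightarrow> cinner x y"
      by (rule tendsto_cinner_left) fact
    show "(\<lambda>n. cinner (X n) y) \<longlonglongrightarrow> 0"
      using assms(1) that by (simp add: orth_def)
  qed
  then show ?thesis
    by (simp add: orth_def)
qed

text \<open>The midpoint of two members of a minimizing sequence stays in \<open>orth S\<close>, so
  the parallelogram law forces the sequence to be Cauchy. Its limit stays in \<open>orth S\<close>
  by \<open>closed_orth\<close>.\<close>

lemma orth_minimizer:
  fixes x :: "'a::chilbert_space"
  obtains p where "p \<in> orth S" "\<And>q. q \<in> orth S \<Longrightarrow> norm (x - p) \<le> norm (x - q)"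
proof -
  define d where "d = (INF q\<in>orth S. (norm (x - q))\<^sup>2)"
  have bdd: "bdd_below ((\<lambda>q. (norm (x - q))\<^sup>2) ` orth S)"
    by (rule bdd_belowI2[of _ 0]) simp
  have d_le: "d \<le> (norm (x - q))\<^sup>2" if "q \<in> orth S" for q
    unfolding d_def by (rule cINF_lower[OF bdd that])
  have "\<exists>q\<in>orth S. (norm (x - q))\<^sup>2 < d + e" if "e > 0" for e
  proof -
    have "Inf ((\<lambda>q. (norm (x - q))\<^sup>2) ` orth S) < d + e"
      using that by (simp add: d_def)
    then show ?thesis
      by (subst (asm) cInf_less_iff[OF _ bdd]) (use orth_zero in auto)
  qed
  then have "\<exists>q\<in>orth S. (norm (x - q))\<^sup>2 < d + 1 / Suc n" for n
    by simp
  then obtain X where X: "\<And>n. X n \<in> orth S" "\<And>n. (norm (x - X n))\<^sup>2 < d + 1 / Suc n"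
    by metis
  have gap: "(norm (X m - X n))\<^sup>2 \<le> 2 / Suc m + 2 / Suc n" for m n
  proof -
    have "(1/2) *\<^sub>R (X m + X n) \<in> orth S"
      using orth_scaleC[OF orth_add[OF X(1) X(1)], of "of_real (1/2)"]
      unfolding scaleC_of_real .
    then have "d \<le> (norm (x - (1/2) *\<^sub>R (X m + X n)))\<^sup>2"
      by (rule d_le)
    moreover have "(norm (X m - X n))\<^sup>2 + 4 * (norm (x - (1/2) *\<^sub>R (X m + X n)))\<^sup>2
        = 2 * (norm (x - X m))\<^sup>2 + 2 * (norm (x - X n))\<^sup>2"
      by (simp add: power2_norm_eq_inner inner_commute algebra_simps)
    ultimately show ?thesis
      using X(2)[of m] X(2)[of n] by simp
  qed
  have "Cauchy X"
  proof (rule CauchyI)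
    fix e :: real assume "e > 0"
    then obtain N where N: "4 / e\<^sup>2 < real N"
      using reals_Archimedean2 by blast
    have "norm (X m - X n) < e" if "m \<ge> N" "n \<ge> N" for m n
    proof -
      have small: "2 / real (Suc k) < e\<^sup>2 / 2" if "k \<ge> N" for k
      proof -
        have "4 < real (Suc k) * e\<^sup>2"
        proof -
          have "4 < real N * e\<^sup>2"
            using N \<open>e > 0\<close> by (simp add: divide_less_eq)
          also have "\<dots> \<le> real (Suc k) * e\<^sup>2"
            using that by (intro mult_right_mono) auto
          finally show ?thesis .
        qed
        then show ?thesis by (simp add: field_simps)
      qed
      then have "(norm (X m - X n))\<^sup>2 < e\<^sup>2"
        using gap[of m n] small[OF that(1)] small[OF that(2)] by linarith
      then show ?thesis
        using \<open>e > 0\<close> by (simp add: power2_less_imp_less)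
    qed
    then show "\<exists>N. \<forall>m\<ge>N. \<forall>n\<ge>N. norm (X m - X n) < e" by blast
  qed
  then obtain p where p: "X \<longlonglongrightarrow> p"
    using Cauchy_convergent convergentD by blast
  have xp: "(norm (x - p))\<^sup>2 \<le> d + 0"
  proof (rule LIMSEQ_le)
    show "(\<lambda>n. (norm (x - X n))\<^sup>2) \<longlonglongrightarrow> (norm (x - p))\<^sup>2"
      by (intro tendsto_intros p)
    show "(\<lambda>n. d + 1 / real (Suc n)) \<longlonglongrightarrow> d + 0"
      using LIMSEQ_inverse_real_of_nat by (intro tendsto_intros) (simp add: inverse_eq_divide)
  qed (use X(2) less_imp_le in blast)
  have "norm (x - p) \<le> norm (x - q)" if "q \<in> orth S" for q
    by (rule power2_le_imp_le[OF order_trans[OF xp[unfolded add_0_right] d_le[OF that]]]) simp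
  then show ?thesis
    using that[of p] closed_orth[OF X(1) p] by blast
qed

text \<open>The nearest point works: if \<open>x - p\<close> had a component along some
  \<open>g\<close> in \<open>orth S\<close>, then moving \<open>p\<close> along \<open>g\<close>
  would bring it strictly closer to \<open>x\<close>.\<close>

lemma orth_proj_exists:
  fixes x :: "'a::chilbert_space"
  obtains p where "p \<in> orth S" "\<And>g. g \<in> orth S \<Longrightarrow> cinner (x - p) g = 0"
proof -
  obtain p where p: "p \<in> orth S" and min: "\<And>q. q \<in> orth S \<Longrightarrow> norm (x - p) \<le> norm (x - q)"
    using orth_minimizer by blast
  have "cinner (x - p) g = 0" if g: "g \<in> orth S" for g
  proof (cases "g = 0")
    case False
    \<comment> \<open>The coefficient of \<open>x - p\<close> along \<open>g\<close>. Removing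
      \<open>c *\<^sub>C g\<close> leaves \<open>y\<close> orthogonal to \<open>g\<close>, and
      Pythagoras against minimality forces \<open>c = 0\<close>.\<close>
    define c where "c = cinner (x - p) g / of_real ((norm g)\<^sup>2)"
    define y where "y = x - p - c *\<^sub>C g"
    have ng: "(norm g)\<^sup>2 \<noteq> 0"
      using False by simp
    have "cinner y g = 0"
      using False by (simp add: y_def c_def cinner_diff_left cinner_scaleC_left cinner_self)
    then have "inner y (c *\<^sub>C g) = 0"
      by (simp add: Re_cinner[symmetric] cinner_scaleC_right)
    then have "(norm (y + c *\<^sub>C g))\<^sup>2 = (norm y)\<^sup>2 + (norm (c *\<^sub>C g))\<^sup>2"
      by (simp add: power2_norm_eq_inner algebra_simps inner_commute)
    moreover have "(norm (y + c *\<^sub>C g))\<^sup>2 \<le> (norm y)\<^sup>2"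
      using min[OF orth_add[OF p orth_scaleC[OF g, of c]]]
      by (simp add: y_def diff_diff_add power_mono)
    ultimately have "(norm (c *\<^sub>C g))\<^sup>2 \<le> 0"
      by simp
    then have "c = 0"
      using False by (simp add: norm_scaleC)
    then show ?thesis
      using False by (simp add: c_def)
  qed simp
  then show ?thesis using that p by blast
qed

text \<open>The difference of two candidates lies in \<open>orth S\<close> and is orthogonal to
  itself. This resolves the definite description in \<open>orth_proj\<close>.\<close>

lemma orth_proj_equality:
  assumes "p \<in> orth S" "\<And>g. g \<in> orth S \<Longrightarrow> cinner (x - p) g = 0"
  shows "orth_proj (orth S) x = p"
  unfolding orth_proj_def
proof (rule the_equality)
  fix q assume q: "q \<in> orth S \<and> (\<forall>g\<in>orth S. cinner (x - q) g = 0)"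
  have "cinner ((x - p) - (x - q)) (q - p) = 0"
    using assms q orth_diff[of q S p] by (simp add: cinner_diff_left)
  then show "q = p"
    by (simp add: cinner_self)
qed (use assms in blast)

lemma orth_proj_in: "orth_proj (orth S) x \<in> orth S"
  and orth_proj_orth: "g \<in> orth S \<Longrightarrow> cinner (x - orth_proj (orth S) x) g = 0"
proof -
  obtain p where p: "p \<in> orth S" "\<And>g. g \<in> orth S \<Longrightarrow> cinner (x - p) g = 0"
    using orth_proj_exists by blast
  note eq = orth_proj_equality[OF p]
  show "orth_proj (orth S) x \<in> orth S"
    by (simp add: eq p(1))
  show "g \<in> orth S \<Longrightarrow> cinner (x - orth_proj (orth S) x) g = 0"
    by (simp add: eq p(2))
qed

lemma cinner_orth_proj_in:
  "g \<in> orth S \<Longrightarrow> cinner (orth_proj (orth S) x) g = cinner x g"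
  using orth_proj_orth[of g S x] by (simp add: cinner_diff_left)

text \<open>Self-adjointness carries weak convergence through the projection: testing projected
  vectors against \<open>y\<close> amounts to testing the original ones against the projection of
  \<open>y\<close>.\<close>

lemma cinner_orth_proj_left:
  "cinner (orth_proj (orth S) x) y = cinner x (orth_proj (orth S) y)"
proof -
  have "cinner (orth_proj (orth S) x) y = cnj (cinner y (orth_proj (orth S) x))"
    by (rule cinner_commute)
  also have "\<dots> = cnj (cinner (orth_proj (orth S) y) (orth_proj (orth S) x))"
    by (simp add: cinner_orth_proj_in orth_proj_in)
  also have "\<dots> = cinner (orth_proj (orth S) x) (orth_proj (orth S) y)"
    by (rule cinner_commute[symmetric])
  also have "\<dots> = cinner x (orth_proj (orth S) y)"
    by (simp add: cinner_orth_proj_in orth_proj_in)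
  finally show ?thesis .
qed

text \<open>By \<open>orth_dist_le\<close> this is the distance from \<open>x\<close> to
  \<open>orth S\<close>. Any explicit element of \<open>orth S\<close> therefore bounds it, without
  computing the projection.\<close>

definition orth_dist :: "'a::chilbert_space set \<Rightarrow> 'a \<Rightarrow> real" where
  "orth_dist S x = norm (x - orth_proj (orth S) x)"

lemma orth_dist_nonneg: "0 \<le> orth_dist S x"
  by (simp add: orth_dist_def)

text \<open>Pythagoras: with \<open>p\<close> the projection of \<open>x\<close>, the vectors
  \<open>x - p\<close> and \<open>p - q\<close> are orthogonal and add up to
  \<open>x - q\<close>.\<close>

lemma orth_dist_le:
  assumes q: "q \<in> orth S"
  shows "orth_dist S x \<le> norm (x - q)"
proof -
  define p where "p = orth_proj (orth S) x"
  have pq: "p - q \<in> orth S"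
    unfolding p_def by (intro orth_diff orth_proj_in q)
  have "inner (x - p) (p - q) = 0"
    using orth_proj_orth[OF pq, of x] by (simp add: p_def Re_cinner[symmetric])
  then have "(norm ((x - p) + (p - q)))\<^sup>2 = (norm (x - p))\<^sup>2 + (norm (p - q))\<^sup>2"
    unfolding power2_norm_eq_inner inner_add_left inner_add_right
    by (simp add: inner_commute[of "p - q" "x - p"])
  then have "(norm (x - p))\<^sup>2 \<le> (norm (x - q))\<^sup>2"
    by simp
  then show ?thesis
    unfolding orth_dist_def p_def by (rule power2_le_imp_le) simp
qed

lemma orth_dist_le_norm: "orth_dist S x \<le> norm x"
  using orth_dist_le[OF orth_zero, of S x] by simp

lemma orth_dist_eq_0: "x \<in> orth S \<Longrightarrow> orth_dist S x = 0"
  using orth_dist_le[of x S x] orth_dist_nonneg[of S x] by simp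

lemma orth_dist_add: "orth_dist S (x + y) \<le> orth_dist S x + orth_dist S y"
proof -
  have "orth_dist S (x + y) \<le> norm (x + y - (orth_proj (orth S) x + orth_proj (orth S) y))"
    by (intro orth_dist_le orth_add orth_proj_in)
  also have "\<dots> \<le> orth_dist S x + orth_dist S y"
    unfolding orth_dist_def add_diff_add by (rule norm_triangle_ineq)
  finally show ?thesis .
qed

lemma norm_orth_proj_le: "norm (orth_proj (orth S) x) \<le> norm x"
proof -
  have "(norm (orth_proj (orth S) x))\<^sup>2 = inner x (orth_proj (orth S) x)"
    using cinner_orth_proj_in[OF orth_proj_in, of S x x]
    by (metis Re_cinner power2_norm_eq_inner)
  also have "\<dots> \<le> norm x * norm (orth_proj (orth S) x)"
    by (rule norm_cauchy_schwarz)
  finally show ?thesis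
    by (cases "orth_proj (orth S) x = 0") (simp_all add: power2_eq_square)
qed

subsection \<open>Multiplication operators on the circle\<close>

lemma space_circ [simp]: "space circ = sphere 0 1"
  by (simp add: circ_def)

lemma sets_circ: "sets circ = sets (restrict_space borel (sphere 0 1))"
  by (simp add: circ_def)

lemma measurable_cis: "cis \<in> uniform_measure lborel A \<rightarrow>\<^sub>M restrict_space borel (sphere 0 1)"
proof (rule measurable_restrict_space2)
  have "cis \<in> borel_measurable borel"
    by (intro borel_measurable_continuous_onI continuous_on_cis continuous_on_id)
  then show "cis \<in> borel_measurable (uniform_measure lborel A)"
    by (simp add: measurable_cong_sets[of "uniform_measure lborel A" borel])
qed auto

lemma emeasure_circ_sphere: "emeasure circ (sphere 0 1) = 1"
proof -
  have [simp]: "cis -` sphere 0 1 = UNIV"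
    by auto
  have "emeasure circ (sphere 0 1) = emeasure (uniform_measure lborel {0..<2 * pi}) UNIV"
    unfolding circ_def by (subst emeasure_distr[OF measurable_cis]) (auto simp: sets_restrict_space)
  also have "\<dots> = 1"
    by (subst emeasure_uniform_measure) (auto intro!: ennreal_divide_self)
  finally show ?thesis .
qed

interpretation circ: finite_measure circ
  by standard (simp add: emeasure_circ_sphere)

lemma AE_circI: "(\<And>z. norm z = 1 \<Longrightarrow> P z) \<Longrightarrow> AE z in circ. P z"
  by (rule AE_I2) simp

lemma continuous_circ_measurable:
  "continuous_on (sphere 0 1) \<phi> \<Longrightarrow> \<phi> \<in> borel_measurable circ"
  for \<phi> :: "complex \<Rightarrow> 'a::topological_space"
  by (simp add: measurable_cong_sets[OF sets_circ refl] borel_measurable_continuous_on_restrict)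

lemma continuous_on_sphere_bounded:
  fixes \<phi> :: "complex \<Rightarrow> complex"
  assumes "continuous_on (sphere 0 1) \<phi>"
  obtains C where "C \<ge> 0" "\<And>z. norm z = 1 \<Longrightarrow> norm (\<phi> z) \<le> C"
proof -
  have "bounded (\<phi> ` sphere 0 1)"
    by (intro compact_imp_bounded compact_continuous_image assms) simp
  then obtain C where "\<forall>z\<in>sphere 0 1. norm (\<phi> z) \<le> C"
    by (auto simp: bounded_iff)
  then show ?thesis
    using that[of "max C 0"] by (auto simp: max.coboundedI1)
qed

lemma ess_bounded_continuous: "continuous_on (sphere 0 1) \<phi> \<Longrightarrow> ess_bounded \<phi>"
  unfolding ess_bounded_def using continuous_circ_measurable continuous_on_sphere_bounded
  by (metis AE_circI)

lemma ess_bounded_const: "ess_bounded (\<lambda>_. c)"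
  by (auto simp: ess_bounded_def)

lemma ess_bounded_cnj: "ess_bounded \<phi> \<Longrightarrow> ess_bounded (\<lambda>z. cnj (\<phi> z))"
  by (auto simp: ess_bounded_def)

lemma ess_bounded_add:
  assumes "ess_bounded \<phi>" "ess_bounded \<psi>"
  shows "ess_bounded (\<lambda>z. \<phi> z + \<psi> z)"
proof -
  obtain C D where "AE z in circ. norm (\<phi> z) \<le> C" "AE z in circ. norm (\<psi> z) \<le> D"
    using assms by (auto simp: ess_bounded_def)
  then have "AE z in circ. norm (\<phi> z + \<psi> z) \<le> C + D"
    by eventually_elim (rule norm_triangle_mono)
  then show ?thesis
    using assms by (auto simp: ess_bounded_def)
qed

lemma ess_bounded_mult:
  assumes "ess_bounded \<phi>" "ess_bounded \<psi>"
  shows "ess_bounded (\<lambda>z. \<phi> z * \<psi> z)"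
proof -
  obtain C D where "AE z in circ. norm (\<phi> z) \<le> C" "AE z in circ. norm (\<psi> z) \<le> D"
    using assms by (auto simp: ess_bounded_def)
  then have "AE z in circ. norm (\<phi> z * \<psi> z) \<le> C * D"
    by eventually_elim (auto simp: norm_mult intro!: mult_mono intro: order_trans[OF norm_ge_zero])
  then show ?thesis
    using assms by (auto simp: ess_bounded_def)
qed

lemma square_integrable_ess_bounded_mult:
  assumes \<phi>: "ess_bounded \<phi>" and f: "square_integrable f"
  shows "square_integrable (\<lambda>z. \<phi> z * f z)"
proof -
  obtain C where C: "AE z in circ. norm (\<phi> z) \<le> C"
    using \<phi> by (auto simp: ess_bounded_def)
  have [measurable]: "\<phi> \<in> borel_measurable circ" "f \<in> borel_measurable circ"
    using \<phi> f by (auto simp: ess_bounded_def square_integrable_def)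
  have "integrable circ (\<lambda>z. (norm (\<phi> z * f z))\<^sup>2)"
  proof (rule Bochner_Integration.integrable_bound)
    show "integrable circ (\<lambda>z. C\<^sup>2 * (norm (f z))\<^sup>2)"
      using f by (simp add: square_integrable_def)
    show "AE z in circ. norm ((norm (\<phi> z * f z))\<^sup>2) \<le> norm (C\<^sup>2 * (norm (f z))\<^sup>2)"
      using C
    proof eventually_elim
      case (elim z)
      then have "(norm (\<phi> z))\<^sup>2 * (norm (f z))\<^sup>2 \<le> C\<^sup>2 * (norm (f z))\<^sup>2"
        by (intro mult_right_mono power_mono) auto
      then show ?case
        by (simp add: norm_mult power_mult_distrib)
    qed
  qed simp
  then show ?thesis
    by (simp add: square_integrable_def)
qed

lemma square_integrable_ess_bounded: "ess_bounded \<phi> \<Longrightarrow> square_integrable \<phi>"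
  using square_integrable_ess_bounded_mult[of \<phi> "\<lambda>_. 1"] by (simp add: square_integrable_def)

section \<open>Passing between functions and their classes, and the algebra of multiplication
  operators\<close>

lemma abs_L2_eqI:
  assumes "square_integrable f" "square_integrable g" "AE z in circ. f z = g z"
  shows "abs_L2 f = abs_L2 g"
  using assms Quotient3_rel_abs[OF Quotient3_L2, of f g] by (simp add: L2_rel_def)

lemma rep_abs_L2:
  assumes "square_integrable f"
  shows "AE z in circ. rep_L2 (abs_L2 f) z = f z" "square_integrable (rep_L2 (abs_L2 f))"
  using rep_abs_rsp_left[OF Quotient3_L2, of f f] assms by (auto simp: L2_rel_def)

lemma square_integrable_rep_L2: "square_integrable (rep_L2 f)"
  by (metis L2_cases rep_abs_L2(2))

lemma abs_rep_L2: "abs_L2 (rep_L2 f) = f"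
  by (rule Quotient3_abs_rep[OF Quotient3_L2])

lemma mult_op_abs_L2:
  assumes "ess_bounded \<phi>" "square_integrable f"
  shows "mult_op \<phi> (abs_L2 f) = abs_L2 (\<lambda>z. \<phi> z * f z)"
  unfolding mult_op_def using rep_abs_L2[OF assms(2)] assms
  by (intro abs_L2_eqI square_integrable_ess_bounded_mult) auto

lemma add_abs_L2:
  assumes "square_integrable f" "square_integrable g"
  shows "abs_L2 f + abs_L2 g = abs_L2 (\<lambda>z. f z + g z)"
  using assms by (intro plus_L2.abs_eq) (auto simp: L2_rel_def)

lemma scaleC_abs_L2: "square_integrable f \<Longrightarrow> c *\<^sub>C abs_L2 f = abs_L2 (\<lambda>z. c * f z)"
  by (intro scaleC_L2.abs_eq) (auto simp: L2_rel_def)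

lemma cinner_abs_L2:
  assumes "square_integrable f" "square_integrable g"
  shows "cinner (abs_L2 f) (abs_L2 g) = (\<integral>z. f z * cnj (g z) \<partial>circ)"
  using assms by (intro cinner_L2.abs_eq) (auto simp: L2_rel_def)

lemma mult_op_cong:
  assumes "ess_bounded \<phi>" "ess_bounded \<psi>" "AE z in circ. \<phi> z = \<psi> z"
  shows "mult_op \<phi> f = mult_op \<psi> f"
  unfolding mult_op_def using assms
  by (intro abs_L2_eqI square_integrable_ess_bounded_mult square_integrable_rep_L2) auto

lemma mult_op_const: "mult_op (\<lambda>_. c) f = c *\<^sub>C f"
  using scaleC_abs_L2[OF square_integrable_rep_L2[of f]] by (simp add: mult_op_def abs_rep_L2)

lemma mult_op_add:
  assumes "ess_bounded \<phi>" "ess_bounded \<psi>"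
  shows "mult_op (\<lambda>z. \<phi> z + \<psi> z) f = mult_op \<phi> f + mult_op \<psi> f"
  unfolding mult_op_def using assms
  by (simp add: add_abs_L2 square_integrable_ess_bounded_mult square_integrable_rep_L2 distrib_right)

lemma mult_op_mult:
  assumes "ess_bounded \<phi>" "ess_bounded \<psi>"
  shows "mult_op \<phi> (mult_op \<psi> f) = mult_op (\<lambda>z. \<phi> z * \<psi> z) f"
  using assms
  by (cases f rule: L2_cases)
     (simp add: mult_op_abs_L2 ess_bounded_mult square_integrable_ess_bounded_mult mult.assoc)

lemma mult_op_add_right:
  assumes "ess_bounded \<phi>"
  shows "mult_op \<phi> (f + g) = mult_op \<phi> f + mult_op \<phi> g"
proof -
  obtain f' g' where "square_integrable f'" "f = abs_L2 f'" "square_integrable g'" "g = abs_L2 g'"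
    by (metis L2_cases)
  then show ?thesis
    using assms by (simp add: add_abs_L2 mult_op_abs_L2 square_integrable_ess_bounded_mult
        square_integrable_add distrib_left)
qed

lemma mult_op_scaleC:
  assumes "ess_bounded \<phi>"
  shows "mult_op \<phi> (c *\<^sub>C f) = c *\<^sub>C mult_op \<phi> f"
  using assms mult_op_mult[OF assms ess_bounded_const[of c], of f]
    mult_op_mult[OF ess_bounded_const[of c] assms, of f]
  by (simp add: mult_op_const mult.commute)

lemma mult_op_diff_right:
  assumes "ess_bounded \<phi>"
  shows "mult_op \<phi> (f - g) = mult_op \<phi> f - mult_op \<phi> g"
  using mult_op_add_right[OF assms, of "f - g" g] by simp

lemma cinner_mult_op:
  assumes "ess_bounded \<phi>"
  shows "cinner (mult_op \<phi> f) g = cinner f (mult_op (\<lambda>z. cnj (\<phi> z)) g)"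
proof -
  obtain f' g' where "square_integrable f'" "f = abs_L2 f'" "square_integrable g'" "g = abs_L2 g'"
    by (metis L2_cases)
  then show ?thesis
    using assms by (simp add: cinner_abs_L2 mult_op_abs_L2 square_integrable_ess_bounded_mult
        ess_bounded_cnj) (simp add: mult_ac)
qed

text \<open>Multiplication operators are normal. In the final contradiction this transfers a lower
  bound from multiplication by \<open>cnj (\<phi> z)\<close> to multiplication by \<phi>.\<close>

lemma norm_mult_op_cnj:
  assumes "ess_bounded \<phi>"
  shows "norm (mult_op (\<lambda>z. cnj (\<phi> z)) f) = norm (mult_op \<phi> f)"
proof -
  have "cinner (mult_op (\<lambda>z. cnj (\<phi> z)) f) (mult_op (\<lambda>z. cnj (\<phi> z)) f)
      = cinner (mult_op \<phi> f) (mult_op \<phi> f)"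
    using assms by (simp add: cinner_mult_op mult_op_mult ess_bounded_cnj mult.commute)
  then show ?thesis
    by (simp add: cinner_self of_real_eq_iff del: of_real_power)
qed

lemma norm_mult_op_le:
  assumes \<phi>: "ess_bounded \<phi>" and C: "C \<ge> 0" "AE z in circ. norm (\<phi> z) \<le> C"
  shows "norm (mult_op \<phi> f) \<le> C * norm f"
proof -
  obtain f' where f': "square_integrable f'" "f = abs_L2 f'"
    by (metis L2_cases)
  have "(norm (mult_op \<phi> f))\<^sup>2 = (\<integral>z. (norm (\<phi> z * f' z))\<^sup>2 \<partial>circ)"
    using f' \<phi> by (simp add: mult_op_abs_L2 norm_sq_abs_L2 square_integrable_ess_bounded_mult)
  also have "\<dots> \<le> (\<integral>z. C\<^sup>2 * (norm (f' z))\<^sup>2 \<partial>circ)"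
  proof (rule integral_mono_AE)
    show "integrable circ (\<lambda>z. (norm (\<phi> z * f' z))\<^sup>2)"
      using square_integrable_ess_bounded_mult[OF \<phi> f'(1)] by (simp add: square_integrable_def)
    show "integrable circ (\<lambda>z. C\<^sup>2 * (norm (f' z))\<^sup>2)"
      using f' by (simp add: square_integrable_def)
    show "AE z in circ. (norm (\<phi> z * f' z))\<^sup>2 \<le> C\<^sup>2 * (norm (f' z))\<^sup>2"
      using C(2)
      by eventually_elim (auto simp: norm_mult power_mult_distrib intro!: mult_right_mono power_mono)
  qed
  also have "\<dots> = (C * norm f)\<^sup>2"
    using f' by (simp add: norm_sq_abs_L2 power_mult_distrib)
  finally show ?thesis
    by (rule power2_le_imp_le) (simp add: C(1))
qed

lemma mult_op_bounded:
  assumes \<phi>: "ess_bounded \<phi>"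
  obtains C where "C \<ge> 0" "\<And>f. norm (mult_op \<phi> f) \<le> C * norm f"
proof -
  obtain C where "AE z in circ. norm (\<phi> z) \<le> C"
    using \<phi> by (auto simp: ess_bounded_def)
  then have "AE z in circ. norm (\<phi> z) \<le> \<bar>C\<bar>"
    by eventually_elim auto
  then show ?thesis
    using that[of "\<bar>C\<bar>"] norm_mult_op_le[OF \<phi>, of "\<bar>C\<bar>"] by simp
qed

subsection \<open>Fourier coefficients\<close>

lemma circ_cnj: "norm z = 1 \<Longrightarrow> cnj z = inverse z"
  using complex_norm_square[of z] by (simp add: inverse_unique)

lemma circ_cnj_powi: "norm z = 1 \<Longrightarrow> cnj (z powi n) = z powi (- n)"
  by (simp add: circ_cnj power_int_inverse power_int_minus)

lemma continuous_on_sphere_powi: "continuous_on (sphere 0 1) (\<lambda>z :: complex. z powi n)"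
  by (intro continuous_on_power_int continuous_on_id) (auto simp: dist_norm)

lemma ess_bounded_powi: "ess_bounded (\<lambda>z. z powi n)"
  by (intro ess_bounded_continuous continuous_on_sphere_powi)

definition monomial :: "int \<Rightarrow> L2" where
  "monomial n = abs_L2 (\<lambda>z. z powi n)"

lemma mult_op_powi_monomial: "mult_op (\<lambda>z. z powi m) (monomial n) = monomial (m + n)"
proof -
  have "z powi m * z powi n = z powi (m + n)" if "norm z = 1" for z :: complex
    using that by (subst power_int_add) auto
  then show ?thesis
    unfolding monomial_def
    by (subst mult_op_abs_L2)
       (auto intro!: abs_L2_eqI ess_bounded_powi square_integrable_ess_bounded ess_bounded_mult AE_circI)
qed

lemma mult_op_monomial_0: "ess_bounded \<phi> \<Longrightarrow> mult_op \<phi> (monomial 0) = abs_L2 \<phi>"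
  unfolding monomial_def
  by (subst mult_op_abs_L2) (auto intro: square_integrable_ess_bounded ess_bounded_const)

text \<open>On the circle \<open>z powi (- n)\<close> is the conjugate of \<open>z powi n\<close>.
  From here on Fourier coefficients are handled as inner products.\<close>

lemma fourier_coeff_eq_cinner: "fourier_coeff f n = cinner f (monomial n)"
proof -
  obtain g where g: "square_integrable g" "f = abs_L2 g"
    by (metis L2_cases)
  then have "fourier_coeff f n = (\<integral>z. g z * z powi (- n) \<partial>circ)"
    by (simp add: fourier_coeff.abs_eq L2_rel_def)
  also have "\<dots> = (\<integral>z. g z * cnj (z powi n) \<partial>circ)"
    by (rule Bochner_Integration.integral_cong) (auto simp: circ_cnj_powi simp del: complex_cnj_power_int)
  also have "\<dots> = cinner f (monomial n)"
    using g by (simp add: monomial_def cinner_abs_L2 square_integrable_ess_bounded ess_bounded_powi)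
  finally show ?thesis .
qed

lemma cinner_mult_op_powi:
  "cinner (mult_op (\<lambda>z. z powi m) f) g = cinner f (mult_op (\<lambda>z. z powi (- m)) g)"
proof -
  have "mult_op (\<lambda>z. cnj (z powi m)) g = mult_op (\<lambda>z. z powi (- m)) g"
    by (intro mult_op_cong ess_bounded_cnj ess_bounded_powi AE_circI circ_cnj_powi)
  then show ?thesis
    by (simp add: cinner_mult_op ess_bounded_powi)
qed

text \<open>Pulled back along \<open>cis\<close>, the integrand has the periodic antiderivative
  \<open>cis (of_int n * t) / (\<i> * of_int n)\<close> when \<open>n\<close> is nonzero.\<close>

lemma integral_powi_circ: "(\<integral>z. z powi n \<partial>circ) = (if n = 0 then 1 else 0)"
proof (cases "n = 0")
  case True
  then show ?thesis
    using emeasure_circ_sphere by (simp add: measure_def)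
next
  case False
  let ?A = "{0..<2 * pi}"
  have [measurable]: "(\<lambda>t. cis (of_int n * t)) \<in> borel_measurable borel"
    by (intro borel_measurable_continuous_onI continuous_on_cis continuous_intros)
  have "(\<integral>z. z powi n \<partial>circ) = (\<integral>t. cis t powi n \<partial>uniform_measure lborel ?A)"
    unfolding circ_def
    by (rule integral_distr[OF measurable_cis])
       (intro borel_measurable_continuous_on_restrict continuous_on_sphere_powi)
  also have "\<dots> = (\<integral>t. cis (of_int n * t) \<partial>density lborel (\<lambda>t. ennreal (indicator ?A t / (2 * pi))))"
  proof -
    have "indicator ?A t / emeasure lborel ?A = ennreal (indicator ?A t / (2 * pi))" for t
      by (subst divide_ennreal[symmetric]) (auto simp: ennreal_indicator)
    then show ?thesis
      by (simp add: uniform_measure_def cis_power_int)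
  qed
  also have "\<dots> = (\<integral>t. (indicator ?A t / (2 * pi)) *\<^sub>R cis (of_int n * t) \<partial>lborel)"
    by (rule integral_density) auto
  \<comment> \<open>The half-open interval is closed up at the null set \<open>{2 * pi}\<close>,
    because the fundamental theorem of calculus is applied on a closed interval.\<close>
  also have "\<dots> = (\<integral>t. (1 / (2 * pi)) *\<^sub>R (indicator {0..2 * pi} t *\<^sub>R cis (of_int n * t)) \<partial>lborel)"
  proof (rule integral_cong_AE)
    show "AE t in lborel. (indicator ?A t / (2 * pi)) *\<^sub>R cis (of_int n * t)
        = (1 / (2 * pi)) *\<^sub>R (indicator {0..2 * pi} t *\<^sub>R cis (of_int n * t))"
      using AE_lborel_singleton[of "2 * pi"]
      by eventually_elim (auto simp: indicator_def)
  qed measurable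
  also have "\<dots> = (1 / (2 * pi)) *\<^sub>R (\<integral>t. indicator {0..2 * pi} t *\<^sub>R cis (of_int n * t) \<partial>lborel)"
    by (rule integral_scaleR_right)
  also have "(\<integral>t. indicator {0..2 * pi} t *\<^sub>R cis (of_int n * t) \<partial>lborel)
      = cis (of_int n * (2 * pi)) / (\<i> * of_int n) - cis (of_int n * 0) / (\<i> * of_int n)"
  proof (rule integral_FTC_atLeastAtMost)
    show "((\<lambda>t. cis (of_int n * t) / (\<i> * of_int n)) has_vector_derivative cis (of_int n * t))
        (at t within {0..2 * pi})" for t
      unfolding has_vector_derivative_def using False
      by (auto intro!: derivative_eq_intros simp: fun_eq_iff field_simps scaleR_conv_of_real)
    show "continuous_on {0..2 * pi} (\<lambda>t. cis (of_int n * t))"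
      by (intro continuous_on_cis continuous_intros)
  qed simp
  also have "cis (of_int n * (2 * pi)) = 1"
    using cis_multiple_2pi[of "of_int n"] by (simp add: mult.commute)
  finally show ?thesis
    using False by simp
qed

lemma cinner_monomial: "cinner (monomial m) (monomial n) = (if m = n then 1 else 0)"
proof -
  have "cinner (monomial m) (monomial n) = (\<integral>z. z powi m * cnj (z powi n) \<partial>circ)"
    by (simp add: monomial_def cinner_abs_L2 square_integrable_ess_bounded ess_bounded_powi)
  also have "\<dots> = (\<integral>z. z powi (m - n) \<partial>circ)"
  proof (rule Bochner_Integration.integral_cong)
    fix z assume "z \<in> space circ"
    then have z: "norm z = 1" by simp
    then have "z powi m * z powi (- n) = z powi (m + - n)"
      by (subst power_int_add) auto
    then show "z powi m * cnj (z powi n) = z powi (m - n)"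
      unfolding circ_cnj_powi[OF z] by simp
  qed simp
  finally show ?thesis
    by (simp add: integral_powi_circ)
qed

section \<open>Stone-Weierstrass on the circle\<close>

lemma continuous_on_real_polynomial_function:
  "real_polynomial_function p \<Longrightarrow> continuous_on S (p :: complex \<Rightarrow> real)"
  by (induction rule: real_polynomial_function.induct)
     (auto intro: continuous_intros linear_continuous_on)

text \<open>Stone-Weierstrass as an induction rule: real polynomials in the coordinates are
  polynomials in \<open>z\<close> and \<open>cnj z\<close>, and approximating real and imaginary
  parts by them reaches every continuous function. It serves once for the completeness of the
  monomials and once for the model space.\<close>

lemma circle_continuous_induct:
  fixes P :: "(complex \<Rightarrow> complex) \<Rightarrow> bool"
  assumes \<phi>: "continuous_on (sphere 0 1) \<phi>"
    and const: "\<And>c. P (\<lambda>_. c)" and id: "P (\<lambda>z. z)" and cnj: "P cnj"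
    and add: "\<And>f g. continuous_on (sphere 0 1) f \<Longrightarrow> continuous_on (sphere 0 1) g \<Longrightarrow> P f \<Longrightarrow> P g \<Longrightarrow> P (\<lambda>z. f z + g z)"
    and mult: "\<And>f g. continuous_on (sphere 0 1) f \<Longrightarrow> continuous_on (sphere 0 1) g \<Longrightarrow> P f \<Longrightarrow> P g \<Longrightarrow> P (\<lambda>z. f z * g z)"
    and lim: "\<And>f. continuous_on (sphere 0 1) f \<Longrightarrow>
      (\<And>e. e > 0 \<Longrightarrow> \<exists>g. continuous_on (sphere 0 1) g \<and> P g \<and> (\<forall>z\<in>sphere 0 1. norm (f z - g z) < e)) \<Longrightarrow> P f"
  shows "P \<phi>"
proof (rule lim[OF \<phi>])
  have poly: "P (\<lambda>z. of_real (p z))" if "real_polynomial_function p" for p :: "complex \<Rightarrow> real"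
    using that
  proof (induction rule: real_polynomial_function.induct)
    case (linear f)
    interpret f: bounded_linear f by fact
    \<comment> \<open>These come from substituting \<open>Re z = (z + cnj z) / 2\<close> and
      \<open>Im z = (z - cnj z) / (2 * \<i>)\<close> into
      \<open>Re z * f 1 + Im z * f \<i>\<close>.\<close>
    define a b where "a = (of_real (f 1) - \<i> * of_real (f \<i>)) / 2"
      and "b = (of_real (f 1) + \<i> * of_real (f \<i>)) / 2"
    have "of_real (f z) = a * z + b * cnj z" for z
    proof -
      have "f z = f (Re z *\<^sub>R 1 + Im z *\<^sub>R \<i>)"
        by (rule arg_cong[of _ _ f]) (simp add: complex_eq_iff)
      also have "\<dots> = Re z * f 1 + Im z * f \<i>"
        by (simp only: f.add f.scaleR real_scaleR_def)
      finally show ?thesis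
        by (simp add: a_def b_def complex_eq_iff field_simps)
    qed
    moreover have "P (\<lambda>z. a * z + b * cnj z)"
      by (intro add mult const id cnj continuous_intros)
    ultimately show ?case by simp
  next
    case (add f g)
    then show ?case
      using assms(5)[of "\<lambda>z. of_real (f z)" "\<lambda>z. of_real (g z)"]
      by (simp add: continuous_on_of_real continuous_on_real_polynomial_function)
  next
    case (mult f g)
    then show ?case
      using assms(6)[of "\<lambda>z. of_real (f z)" "\<lambda>z. of_real (g z)"]
      by (simp add: continuous_on_of_real continuous_on_real_polynomial_function)
  qed (rule const)
  fix e :: real assume "e > 0"
  then have e2: "e / 2 > 0" by simp
  have re: "continuous_on (sphere 0 1) (\<lambda>z. Re (\<phi> z))" "continuous_on (sphere 0 1) (\<lambda>z. Im (\<phi> z))"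
    by (intro continuous_intros \<phi>)+
  obtain p where p: "real_polynomial_function p" "\<And>z. z \<in> sphere 0 1 \<Longrightarrow> \<bar>Re (\<phi> z) - p z\<bar> < e / 2"
    using Stone_Weierstrass_real_polynomial_function[OF compact_sphere re(1) e2] by blast
  obtain q where q: "real_polynomial_function q" "\<And>z. z \<in> sphere 0 1 \<Longrightarrow> \<bar>Im (\<phi> z) - q z\<bar> < e / 2"
    using Stone_Weierstrass_real_polynomial_function[OF compact_sphere re(2) e2] by blast
  define g where "g z = of_real (p z) + \<i> * of_real (q z)" for z
  have cont: "continuous_on (sphere 0 1) (\<lambda>z. of_real (p z) :: complex)"
    "continuous_on (sphere 0 1) (\<lambda>z. of_real (q z) :: complex)"
    using p q by (auto intro: continuous_on_of_real continuous_on_real_polynomial_function)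
  show "\<exists>g. continuous_on (sphere 0 1) g \<and> P g \<and> (\<forall>z\<in>sphere 0 1. norm (\<phi> z - g z) < e)"
  proof (intro exI[of _ g] conjI ballI)
    show "continuous_on (sphere 0 1) g"
      unfolding g_def by (intro continuous_intros cont)
    show "P g"
      unfolding g_def by (intro add mult const poly p q cont continuous_intros)
    show "norm (\<phi> z - g z) < e" if "z \<in> sphere 0 1" for z
      using p(2)[OF that] q(2)[OF that] cmod_le[of "\<phi> z - g z"] by (simp add: g_def)
  qed
qed

subsection \<open>Completeness of the monomials\<close>

text \<open>The orthogonal complement of the trigonometric polynomials, to be shown trivial in
  \<open>monomial_null_eq_0\<close>.\<close>

definition monomial_null :: "L2 set" where
  "monomial_null = {r. \<forall>n. cinner r (monomial n) = 0}"

text \<open>A class of symbols that is enlarged step by step: powers of \<open>z\<close>, continuous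
  functions, indicators of closed sets, indicators of Borel sets.\<close>

definition null_preserving :: "(complex \<Rightarrow> complex) \<Rightarrow> bool" where
  "null_preserving \<phi> \<longleftrightarrow> ess_bounded \<phi> \<and> (\<forall>r\<in>monomial_null. mult_op \<phi> r \<in> monomial_null)"

lemma null_preserving_const: "null_preserving (\<lambda>_. c)"
  by (simp add: null_preserving_def ess_bounded_const monomial_null_def mult_op_const cinner_scaleC_left)

lemma null_preserving_add:
  "null_preserving \<phi> \<Longrightarrow> null_preserving \<psi> \<Longrightarrow> null_preserving (\<lambda>z. \<phi> z + \<psi> z)"
  by (simp add: null_preserving_def ess_bounded_add monomial_null_def mult_op_add cinner_add_left)

lemma null_preserving_mult:
  "null_preserving \<phi> \<Longrightarrow> null_preserving \<psi> \<Longrightarrow> null_preserving (\<lambda>z. \<phi> z * \<psi> z)"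
  by (simp add: null_preserving_def ess_bounded_mult mult_op_mult[symmetric])

text \<open>The adjoint of multiplication by a power of \<open>z\<close> permutes the
  monomials.\<close>

lemma null_preserving_powi: "null_preserving (\<lambda>z. z powi n)"
  by (simp add: null_preserving_def ess_bounded_powi monomial_null_def cinner_mult_op_powi
      mult_op_powi_monomial)

lemma null_preserving_cong:
  assumes "null_preserving \<phi>" "ess_bounded \<psi>" "AE z in circ. \<psi> z = \<phi> z"
  shows "null_preserving \<psi>"
proof -
  have "mult_op \<psi> r = mult_op \<phi> r" for r
    using assms by (intro mult_op_cong) (auto simp: null_preserving_def)
  then show ?thesis
    using assms by (simp add: null_preserving_def)
qed

lemma null_preserving_continuous:
  assumes "continuous_on (sphere 0 1) \<phi>"
  shows "null_preserving \<phi>"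
  using assms
proof (rule circle_continuous_induct)
  show "null_preserving (\<lambda>z. z)"
    using null_preserving_powi[of 1] by simp
  show "null_preserving cnj"
    by (rule null_preserving_cong[OF null_preserving_powi[of "-1"]])
       (auto intro!: ess_bounded_continuous AE_circI continuous_intros simp: circ_cnj power_int_minus)
next
  fix f :: "complex \<Rightarrow> complex"
  assume f: "continuous_on (sphere 0 1) f"
  assume approx: "\<And>e. e > 0 \<Longrightarrow> \<exists>g. continuous_on (sphere 0 1) g \<and> null_preserving g \<and>
      (\<forall>z\<in>sphere 0 1. norm (f z - g z) < e)"
  have "cinner (mult_op f r) (monomial n) = 0" if r: "r \<in> monomial_null" for r n
  proof -
    have "norm (cinner (mult_op f r) (monomial n)) \<le> 0 + e" if "e > 0" for e
    proof -
      \<comment> \<open>The summand 1 keeps the denominator positive even for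
        \<open>r = 0\<close>.\<close>
      define d where "d = e / (norm r * norm (monomial n) + 1)"
      have pos: "norm r * norm (monomial n) + 1 > 0"
        by (simp add: add_nonneg_pos)
      then have d: "d > 0"
        using that by (simp add: d_def)
      then obtain g where g: "continuous_on (sphere 0 1) g" "null_preserving g"
          "\<And>z. z \<in> sphere 0 1 \<Longrightarrow> norm (f z - g z) < d"
        using approx by blast
      have fg: "continuous_on (sphere 0 1) (\<lambda>z. f z - g z)"
        by (intro continuous_intros f g)
      have "mult_op f r = mult_op (\<lambda>z. f z - g z) r + mult_op g r"
        using mult_op_add[OF ess_bounded_continuous[OF fg] ess_bounded_continuous[OF g(1)], of r] by simp
      moreover have "cinner (mult_op g r) (monomial n) = 0"
        using g(2) r by (simp add: null_preserving_def monomial_null_def)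
      ultimately have "norm (cinner (mult_op f r) (monomial n))
          \<le> norm (mult_op (\<lambda>z. f z - g z) r) * norm (monomial n)"
        using norm_cinner_le_mult by (simp add: cinner_add_left)
      also have "\<dots> \<le> (d * norm r) * norm (monomial n)"
        by (intro mult_right_mono norm_mult_op_le ess_bounded_continuous fg AE_circI)
           (use d g(3) in \<open>auto intro: less_imp_le\<close>)
      also have "\<dots> \<le> d * (norm r * norm (monomial n) + 1)"
        using d by (simp add: algebra_simps)
      also have "\<dots> = e"
        using pos by (simp add: d_def)
      finally show ?thesis by simp
    qed
    then have "norm (cinner (mult_op f r) (monomial n)) \<le> 0"
      by (rule field_le_epsilon)
    then show ?thesis by simp
  qed
  then show "null_preserving f"
    by (simp add: null_preserving_def monomial_null_def ess_bounded_continuous[OF f])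
qed (simp_all add: null_preserving_const null_preserving_add null_preserving_mult)

text \<open>Dominated convergence, with \<open>norm (f z)\<close> as the dominating function. It is
  integrable because \<open>circ\<close> is finite and \<open>f\<close> is square
  integrable.\<close>

lemma null_preserving_pointwise_limit:
  assumes "\<And>k. null_preserving (\<phi> k)" "\<And>k z. norm z = 1 \<Longrightarrow> norm (\<phi> k z) \<le> 1"
    and lim: "\<And>z. norm z = 1 \<Longrightarrow> (\<lambda>k. \<phi> k z) \<longlonglongrightarrow> \<psi> z"
  shows "null_preserving \<psi>"
proof -
  have bdd: "ess_bounded (\<phi> k)" for k
    using assms(1) by (simp add: null_preserving_def)
  have measurable_\<phi> [measurable]: "\<phi> k \<in> borel_measurable circ" for k
    using bdd by (simp add: ess_bounded_def)
  have [measurable]: "\<psi> \<in> borel_measurable circ"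
    by (rule borel_measurable_LIMSEQ_metric[of \<phi>]) (use lim in auto)
  have "norm (\<psi> z) \<le> 1" if "norm z = 1" for z
    by (rule LIMSEQ_le_const2[OF tendsto_norm[OF lim[OF that]]]) (use assms(2) that in auto)
  then have bdd_\<psi>: "ess_bounded \<psi>"
    unfolding ess_bounded_def by (auto intro!: AE_circI)
  have "cinner (mult_op \<psi> r) (monomial n) = 0" if r: "r \<in> monomial_null" for r n
  proof -
    obtain f where f: "square_integrable f" "r = abs_L2 f"
      by (metis L2_cases)
    have [measurable]: "f \<in> borel_measurable circ" "(\<lambda>z. z powi n) \<in> borel_measurable circ"
      using f(1) ess_bounded_powi by (auto simp: square_integrable_def ess_bounded_def)
    have cinner_eq: "cinner (mult_op \<phi>' r) (monomial n) = (\<integral>z. \<phi>' z * f z * cnj (z powi n) \<partial>circ)"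
      if "ess_bounded \<phi>'" for \<phi>'
      using f that by (simp add: mult_op_abs_L2 monomial_def cinner_abs_L2 square_integrable_ess_bounded
          square_integrable_ess_bounded_mult ess_bounded_powi)
    have "(\<lambda>k. \<integral>z. \<phi> k z * f z * cnj (z powi n) \<partial>circ) \<longlonglongrightarrow> (\<integral>z. \<psi> z * f z * cnj (z powi n) \<partial>circ)"
    proof (rule integral_dominated_convergence)
      show "integrable circ (\<lambda>z. norm (f z))"
        using integrable_norm[OF integrable_cinner_L2[OF f(1), of "\<lambda>_. 1"]]
        by (simp add: cinner_complex_def square_integrable_def)
      show "AE z in circ. (\<lambda>k. \<phi> k z * f z * cnj (z powi n)) \<longlonglongrightarrow> \<psi> z * f z * cnj (z powi n)"
        by (intro AE_circI tendsto_intros lim)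
      show "AE z in circ. norm (\<phi> k z * f z * cnj (z powi n)) \<le> norm (f z)" for k
        by (intro AE_circI) (use assms(2)[of _ k] in \<open>simp add: norm_mult norm_power_int mult_left_le_one_le\<close>)
    qed measurable
    moreover have "(\<integral>z. \<phi> k z * f z * cnj (z powi n) \<partial>circ) = 0" for k
      using assms(1)[of k] r cinner_eq[OF bdd[of k]]
      by (simp add: null_preserving_def monomial_null_def del: complex_cnj_power_int)
    ultimately show ?thesis
      using cinner_eq[OF bdd_\<psi>] LIMSEQ_unique[OF _ tendsto_const] by (simp del: complex_cnj_power_int)
  qed
  then show ?thesis
    using bdd_\<psi> by (simp add: null_preserving_def monomial_null_def)
qed

text \<open>The indicator is the pointwise limit of the continuous tents
  \<open>max 0 (1 - real k * infdist z B)\<close>.\<close>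

lemma null_preserving_indicator_closed:
  fixes B :: "complex set"
  assumes "closed B"
  shows "null_preserving (indicator B)"
\<comment> \<open>By convention \<open>infdist z {} = 0\<close>, so for the empty set the tents
  would be constantly 1.\<close>
proof (cases "B = {}")
  case True
  then have "indicator B = (\<lambda>_. 0 :: complex)"
    by (simp add: fun_eq_iff)
  then show ?thesis
    using null_preserving_const[of 0] by simp
next
  case False
  define \<phi> where "\<phi> k z = complex_of_real (max 0 (1 - real k * infdist z B))" for k z
  show ?thesis
  proof (rule null_preserving_pointwise_limit[of \<phi>])
    show "null_preserving (\<phi> k)" for k
      unfolding \<phi>_def by (intro null_preserving_continuous continuous_intros)
    show "norm (\<phi> k z) \<le> 1" for k z
      unfolding \<phi>_def norm_of_real by (simp add: infdist_nonneg)
    show "(\<lambda>k. \<phi> k z) \<longlonglongrightarrow> indicator B z" for z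
    proof (cases "z \<in> B")
      case True
      then show ?thesis
        by (simp add: \<phi>_def)
    next
      case False
      then have pos: "infdist z B > 0"
        using assms \<open>B \<noteq> {}\<close> infdist_nonneg[of z B] in_closed_iff_infdist_zero[of B z] by linarith
      obtain N where N: "1 / infdist z B < real N"
        using reals_Archimedean2 by blast
      have "\<phi> k z = indicator B z" if "k \<ge> N" for k
      proof -
        have "1 / infdist z B \<le> real k"
          using N that by linarith
        then have "1 \<le> real k * infdist z B"
          using pos by (simp add: divide_le_eq)
        then show ?thesis
          using False by (simp add: \<phi>_def)
      qed
      then show ?thesis
        by (intro tendsto_eventually) (auto simp: eventually_sequentially)
    qed
  qed
qed

text \<open>Induction over the sigma-algebra generated by the closed sets. Countable unions are
  pointwise limits of finite ones.\<close>

lemma null_preserving_indicator: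
  fixes B :: "complex set"
  assumes "B \<in> sets borel"
  shows "null_preserving (indicator B)"
proof -
  have "B \<in> sigma_sets UNIV (Collect closed)"
    using assms by (simp add: borel_eq_closed)
  then show ?thesis
  proof induction
    case (Basic B)
    then show ?case by (simp add: null_preserving_indicator_closed)
  next
    case Empty
    have "indicator {} = (\<lambda>_. 0 :: complex)"
      by (simp add: fun_eq_iff)
    then show ?case using null_preserving_const[of 0] by simp
  next
    case (Compl B)
    have "indicator (UNIV - B) = (\<lambda>z. 1 + (-1) * indicator B z :: complex)"
      by (auto simp: fun_eq_iff indicator_def)
    then show ?case
      using null_preserving_add[OF null_preserving_const[of 1]
          null_preserving_mult[OF null_preserving_const[of "-1"] Compl.IH]] by simp
  next
    case (Union B)
    define \<phi> where "\<phi> k = (indicator (\<Union>i<k. B i) :: complex \<Rightarrow> complex)" for k :: nat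
    show ?case
    proof (rule null_preserving_pointwise_limit[of \<phi>])
      show "null_preserving (\<phi> k)" for k
      proof (induction k)
        case 0
        have "\<phi> 0 = (\<lambda>_. 0)"
          by (simp add: \<phi>_def fun_eq_iff)
        then show ?case using null_preserving_const[of 0] by simp
      next
        case (Suc k)
        \<comment> \<open>Inclusion-exclusion, since the sets \<open>B i\<close> may
          overlap.\<close>
        have "\<phi> (Suc k) = (\<lambda>z. (\<phi> k z + indicator (B k) z) + (-1) * (\<phi> k z * indicator (B k) z))"
          by (auto simp: fun_eq_iff \<phi>_def indicator_def less_Suc_eq)
        then show ?case
          by (simp only:) (intro null_preserving_add null_preserving_mult null_preserving_const Suc Union.IH)
      qed
      show "norm (\<phi> k z) \<le> 1" for k z
        by (simp add: \<phi>_def indicator_def)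
      show "(\<lambda>k. \<phi> k z) \<longlonglongrightarrow> indicator (\<Union>i. B i) z" for z
        unfolding \<phi>_def by (rule LIMSEQ_indicator_UN)
    qed
  qed
qed

text \<open>The integral of \<open>f\<close> over a Borel set \<open>B\<close> is the zeroth
  coefficient of the product with its indicator, hence 0. A function all of whose integrals over
  measurable sets vanish is zero almost everywhere.\<close>

lemma monomial_null_eq_0:
  assumes r: "r \<in> monomial_null"
  shows "r = 0"
proof -
  obtain f where f: "square_integrable f" "r = abs_L2 f"
    by (metis L2_cases)
  have "AE z in circ. f z = 0"
  proof (rule circ.density_unique_banach)
    show "integrable circ f"
      using integrable_cinner_L2[OF f(1), of "\<lambda>_. 1"]
      by (simp add: cinner_complex_def square_integrable_def)
    fix A assume "A \<in> sets circ"
    then obtain B where B: "B \<in> sets borel" "A = sphere 0 1 \<inter> B"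
      by (auto simp: sets_circ sets_restrict_space)
    have ind: "null_preserving (indicator B)"
      by (rule null_preserving_indicator) fact
    have "set_lebesgue_integral circ A f = (\<integral>z. indicator B z * f z \<partial>circ)"
      unfolding set_lebesgue_integral_def B(2)
      by (rule Bochner_Integration.integral_cong) (auto simp: indicator_def)
    also have "\<dots> = cinner (mult_op (indicator B) r) (monomial 0)"
      using f ind by (simp add: mult_op_abs_L2 monomial_def cinner_abs_L2 null_preserving_def
          square_integrable_ess_bounded_mult square_integrable_ess_bounded ess_bounded_const)
    also have "\<dots> = 0"
      using ind r by (simp add: null_preserving_def monomial_null_def)
    finally show "set_lebesgue_integral circ A f = set_lebesgue_integral circ A (\<lambda>_. 0)"
      by (simp add: set_lebesgue_integral_def)
  qed simp
  then show ?thesis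
    unfolding f(2) zero_L2_def by (intro abs_L2_eqI f) (auto simp: square_integrable_zero)
qed

section \<open>Powers of the bilateral shift\<close>

text \<open>A unitary operator: \<open>shift (- m)\<close> is the adjoint of \<open>shift m\<close>
  by \<open>cinner_shift\<close> and its inverse by \<open>shift_shift_minus\<close>.\<close>

definition shift :: "int \<Rightarrow> L2 \<Rightarrow> L2" where
  "shift m = mult_op (\<lambda>z. z powi m)"

lemma shift_monomial: "shift m (monomial n) = monomial (m + n)"
  by (simp add: shift_def mult_op_powi_monomial)

lemma cinner_shift: "cinner (shift m f) g = cinner f (shift (- m) g)"
  unfolding shift_def by (rule cinner_mult_op_powi)

lemma cinner_shift_monomial: "cinner (shift m f) (monomial n) = cinner f (monomial (n - m))"
  by (simp add: cinner_shift shift_monomial)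

lemma shift_shift_minus: "shift m (shift (- m) f) = f"
proof -
  have "mult_op (\<lambda>z. z powi m * z powi (- m)) f = mult_op (\<lambda>_. 1) f"
  proof (intro mult_op_cong ess_bounded_mult ess_bounded_powi ess_bounded_const AE_circI)
    fix z :: complex assume "norm z = 1"
    then show "z powi m * z powi (- m) = 1"
      by (subst power_int_add[symmetric]) auto
  qed
  then show ?thesis
    by (simp only: shift_def mult_op_mult ess_bounded_powi mult_op_const)
       (simp add: scaleC_of_real[of 1, simplified])
qed

lemma mult_op_shift: "ess_bounded u \<Longrightarrow> mult_op u (shift m f) = shift m (mult_op u f)"
  by (simp add: shift_def mult_op_mult ess_bounded_powi) (simp add: mult.commute)

subsection \<open>Model spaces\<close>

lemma H2_eq_orth: "H2 = orth (monomial ` {..<0})"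
  by (auto simp: H2_def orth_def fourier_coeff_eq_cinner)

lemma H2D: "f \<in> H2 \<Longrightarrow> n < 0 \<Longrightarrow> cinner f (monomial n) = 0"
  by (simp add: H2_def fourier_coeff_eq_cinner)

lemma H2I: "(\<And>n. n < 0 \<Longrightarrow> cinner f (monomial n) = 0) \<Longrightarrow> f \<in> H2"
  by (simp add: H2_def fourier_coeff_eq_cinner)

text \<open>Elements of \<open>H2\<close> lie in the closed span of the monomials of nonnegative
  degree, expressed here as the double complement \<open>orth W\<close>. The projection of
  \<open>g\<close> to it has the same Fourier coefficients as \<open>g\<close>, so completeness
  identifies the two.\<close>

lemma cinner_H2_eq_0:
  assumes g: "g \<in> H2" and w: "\<And>m. m \<ge> 0 \<Longrightarrow> cinner (monomial m) w = 0"
  shows "cinner g w = 0"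
proof -
  define W where "W = {w. \<forall>m\<ge>0. cinner (monomial m) w = 0}"
  define p where "p = orth_proj (orth W) g"
  have p: "p \<in> orth W"
    unfolding p_def by (rule orth_proj_in)
  have "cinner (g - p) (monomial n) = 0" for n
  proof (cases "n \<ge> 0")
    case True
    then have "monomial n \<in> orth W"
      by (simp add: orth_def W_def)
    then show ?thesis
      unfolding p_def by (rule orth_proj_orth)
  next
    case False
    \<comment> \<open>By orthonormality a monomial of negative degree is in \<open>W\<close>, so it
      is orthogonal to \<open>p\<close> as well as to \<open>g\<close>.\<close>
    then have "monomial n \<in> W"
      by (simp add: W_def cinner_monomial)
    then have "cinner p (monomial n) = 0"
      using p by (simp add: orth_def)
    then show ?thesis
      using H2D[OF g] False by (simp add: cinner_diff_left)
  qed
  then have "g = p"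
    using monomial_null_eq_0[of "g - p"] by (simp add: monomial_null_def)
  then show ?thesis
    using p w by (simp add: orth_def W_def)
qed

text \<open>After moving \<open>u\<close> to the other side, \<open>cinner_H2_eq_0\<close> reduces
  \<open>g\<close> to a monomial of degree \<open>m \<ge> 0\<close>. There the product with
  \<open>u\<close> is a forward shift of \<open>u\<close>.\<close>

lemma mult_op_H2:
  assumes u: "ess_bounded u" "abs_L2 u \<in> H2" and g: "g \<in> H2"
  shows "mult_op u g \<in> H2"
proof (rule H2I)
  fix n :: int assume n: "n < 0"
  have "cinner (monomial m) (mult_op (\<lambda>z. cnj (u z)) (monomial n)) = 0" if "m \<ge> 0" for m
  proof -
    have "mult_op u (monomial m) = shift m (mult_op u (monomial 0))"
      using mult_op_shift[OF u(1), of m "monomial 0"] by (simp add: shift_monomial)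
    then have "cinner (monomial m) (mult_op (\<lambda>z. cnj (u z)) (monomial n))
        = cinner (abs_L2 u) (monomial (n - m))"
      by (simp add: cinner_mult_op[OF u(1), symmetric] mult_op_monomial_0[OF u(1)]
          cinner_shift_monomial)
    then show ?thesis
      using H2D[OF u(2)] n that by simp
  qed
  then show "cinner (mult_op u g) (monomial n) = 0"
    unfolding cinner_mult_op[OF u(1)] by (rule cinner_H2_eq_0[OF g])
qed

text \<open>Orthogonality to the negative monomials encodes membership in \<open>H2\<close>, so the
  model space becomes a single orthogonal complement and the projection results apply.\<close>

definition model_orth :: "(complex \<Rightarrow> complex) \<Rightarrow> L2 set" where
  "model_orth u = monomial ` {..<0} \<union> mult_op u ` H2"

lemma model_space_eq_orth: "model_space u = orth (model_orth u)"
  unfolding model_space_def H2_eq_orth model_orth_def by (auto simp: orth_def)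

lemma model_spaceI:
  assumes "\<And>n. n < 0 \<Longrightarrow> cinner f (monomial n) = 0" "\<And>g. g \<in> H2 \<Longrightarrow> cinner f (mult_op u g) = 0"
  shows "f \<in> model_space u"
  using assms H2I by (simp add: model_space_def)

lemma model_spaceD:
  assumes "f \<in> model_space u"
  shows "f \<in> H2" "g \<in> H2 \<Longrightarrow> cinner f (mult_op u g) = 0"
  using assms by (simp_all add: model_space_def)

section \<open>Symbols that almost preserve the model space\<close>

text \<open>The bound makes the error of a uniformly approximated symbol uniform along the
  sequence.\<close>

definition bounded_weakly_null :: "(nat \<Rightarrow> 'a::complex_inner) \<Rightarrow> bool" where
  "bounded_weakly_null h \<longleftrightarrow> (\<exists>B. \<forall>n. norm (h n) \<le> B) \<and> (\<forall>x. (\<lambda>n. cinner (h n) x) \<longlonglongrightarrow> 0)"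

text \<open>
  The operator \<open>P\<^sub>u\<^sup>\<bottom> M\<^sub>\<phi>\<close> restricted to the model space is completely
  continuous. Stating this by weakly null sequences makes the set of such \<open>\<phi>\<close> an algebra.
\<close>

definition almost_invariant :: "(complex \<Rightarrow> complex) \<Rightarrow> (complex \<Rightarrow> complex) \<Rightarrow> bool" where
  "almost_invariant u \<phi> \<longleftrightarrow> ess_bounded \<phi> \<and>
     (\<forall>h. (\<forall>n. h n \<in> model_space u) \<longrightarrow> bounded_weakly_null h \<longrightarrow>
       (\<lambda>n. orth_dist (model_orth u) (mult_op \<phi> (h n))) \<longlonglongrightarrow> 0)"

lemma almost_invariantI:
  assumes "ess_bounded \<phi>"
    and "\<And>h. (\<And>n. h n \<in> model_space u) \<Longrightarrow> bounded_weakly_null h \<Longrightarrow>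
      (\<lambda>n. orth_dist (model_orth u) (mult_op \<phi> (h n))) \<longlonglongrightarrow> 0"
  shows "almost_invariant u \<phi>"
  using assms by (simp add: almost_invariant_def)

lemma almost_invariantD:
  assumes "almost_invariant u \<phi>" "\<And>n. h n \<in> model_space u" "bounded_weakly_null h"
  shows "(\<lambda>n. orth_dist (model_orth u) (mult_op \<phi> (h n))) \<longlonglongrightarrow> 0"
  using assms by (simp add: almost_invariant_def)

lemma tendsto_orth_dist_0:
  assumes "\<And>n. orth_dist S (X n) \<le> Y n" "Y \<longlonglongrightarrow> 0"
  shows "(\<lambda>n. orth_dist S (X n)) \<longlonglongrightarrow> 0"
  by (rule Lim_null_comparison[OF always_eventually assms(2)]) (simp add: assms(1) orth_dist_nonneg)

lemma almost_invariant_const: "almost_invariant u (\<lambda>_. c)"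
proof (rule almost_invariantI[OF ess_bounded_const])
  fix h :: "nat \<Rightarrow> L2" assume "\<And>n. h n \<in> model_space u"
  then have "orth_dist (model_orth u) (mult_op (\<lambda>_. c) (h n)) = 0" for n
    by (intro orth_dist_eq_0) (simp add: mult_op_const orth_scaleC model_space_eq_orth)
  then show "(\<lambda>n. orth_dist (model_orth u) (mult_op (\<lambda>_. c) (h n))) \<longlonglongrightarrow> 0"
    by simp
qed

lemma almost_invariant_add:
  assumes "almost_invariant u \<phi>" "almost_invariant u \<psi>"
  shows "almost_invariant u (\<lambda>z. \<phi> z + \<psi> z)"
proof (rule almost_invariantI)
  have bdd: "ess_bounded \<phi>" "ess_bounded \<psi>"
    using assms by (auto simp: almost_invariant_def)
  then show "ess_bounded (\<lambda>z. \<phi> z + \<psi> z)"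
    by (rule ess_bounded_add)
  fix h assume h: "\<And>n. h n \<in> model_space u" "bounded_weakly_null h"
  show "(\<lambda>n. orth_dist (model_orth u) (mult_op (\<lambda>z. \<phi> z + \<psi> z) (h n))) \<longlonglongrightarrow> 0"
  proof (rule tendsto_orth_dist_0)
    show "(\<lambda>n. orth_dist (model_orth u) (mult_op \<phi> (h n)) + orth_dist (model_orth u) (mult_op \<psi> (h n))) \<longlonglongrightarrow> 0"
      by (intro tendsto_add_zero almost_invariantD assms h)
  qed (simp add: mult_op_add bdd orth_dist_add)
qed

text \<open>Let \<open>k n\<close> be the projection of \<psi> times \<open>h n\<close>. It is again
  a bounded weakly null sequence in the model space, so \<phi> can act on it; what the projection
  drops tends to 0 in norm by the assumption on \<psi>.\<close>

lemma almost_invariant_mult: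
  assumes "almost_invariant u \<phi>" "almost_invariant u \<psi>"
  shows "almost_invariant u (\<lambda>z. \<phi> z * \<psi> z)"
proof (rule almost_invariantI)
  let ?S = "model_orth u"
  have bdd: "ess_bounded \<phi>" "ess_bounded \<psi>"
    using assms by (auto simp: almost_invariant_def)
  then show "ess_bounded (\<lambda>z. \<phi> z * \<psi> z)"
    by (rule ess_bounded_mult)
  fix h assume h: "\<And>n. h n \<in> model_space u" "bounded_weakly_null h"
  define k where "k n = orth_proj (orth ?S) (mult_op \<psi> (h n))" for n
  have k: "k n \<in> model_space u" for n
    unfolding k_def model_space_eq_orth by (rule orth_proj_in)
  have k_null: "bounded_weakly_null k"
    unfolding bounded_weakly_null_def
  proof (intro conjI allI)
    obtain B where B: "\<And>n. norm (h n) \<le> B"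
      using h(2) by (auto simp: bounded_weakly_null_def)
    obtain C where C: "C \<ge> 0" "\<And>f. norm (mult_op \<psi> f) \<le> C * norm f"
      using mult_op_bounded[OF bdd(2)] by blast
    have "norm (k n) \<le> C * B" for n
      unfolding k_def
      by (rule order_trans[OF norm_orth_proj_le order_trans[OF C(2) mult_left_mono[OF B C(1)]]])
    then show "\<exists>B. \<forall>n. norm (k n) \<le> B"
      by blast
    show "(\<lambda>n. cinner (k n) x) \<longlonglongrightarrow> 0" for x
      using h(2) unfolding k_def cinner_orth_proj_left cinner_mult_op[OF bdd(2)]
      by (simp add: bounded_weakly_null_def)
  qed
  obtain C where C: "C \<ge> 0" "\<And>f. norm (mult_op \<phi> f) \<le> C * norm f"
    using mult_op_bounded[OF bdd(1)] by blast
  show "(\<lambda>n. orth_dist ?S (mult_op (\<lambda>z. \<phi> z * \<psi> z) (h n))) \<longlonglongrightarrow> 0"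
  proof (rule tendsto_orth_dist_0)
    show "(\<lambda>n. orth_dist ?S (mult_op \<phi> (k n)) + C * orth_dist ?S (mult_op \<psi> (h n))) \<longlonglongrightarrow> 0"
      by (intro tendsto_add_zero tendsto_mult_right_zero almost_invariantD assms h k k_null)
    fix n
    have "mult_op (\<lambda>z. \<phi> z * \<psi> z) (h n) = mult_op \<phi> (k n) + mult_op \<phi> (mult_op \<psi> (h n) - k n)"
      by (simp add: mult_op_mult[OF bdd] mult_op_diff_right[OF bdd(1)])
    moreover have "norm (mult_op \<phi> (mult_op \<psi> (h n) - k n)) \<le> C * orth_dist ?S (mult_op \<psi> (h n))"
      using C(2) by (simp add: orth_dist_def k_def)
    ultimately show "orth_dist ?S (mult_op (\<lambda>z. \<phi> z * \<psi> z) (h n))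
        \<le> orth_dist ?S (mult_op \<phi> (k n)) + C * orth_dist ?S (mult_op \<psi> (h n))"
      using orth_dist_add[of ?S "mult_op \<phi> (k n)" "mult_op \<phi> (mult_op \<psi> (h n) - k n)"]
        orth_dist_le_norm[of ?S "mult_op \<phi> (mult_op \<psi> (h n) - k n)"] by simp
  qed
qed

lemma cinner_mult_op_inner_function:
  assumes "inner_function u"
  shows "cinner (mult_op u f) (mult_op u g) = cinner f g"
proof -
  have u: "ess_bounded u" "AE z in circ. norm (u z) = 1"
    using assms by (auto simp: inner_function_def)
  have "AE z in circ. cnj (u z) * u z = 1"
    using u(2) by eventually_elim (metis complex_norm_square mult.commute of_real_1 one_power2)
  then have "mult_op (\<lambda>z. cnj (u z) * u z) g = mult_op (\<lambda>_. 1) g"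
    using u by (intro mult_op_cong) (auto intro: ess_bounded_mult ess_bounded_cnj ess_bounded_const)
  then show ?thesis
    using u(1) by (simp add: cinner_mult_op mult_op_mult ess_bounded_cnj mult_op_const
        scaleC_of_real[of 1, simplified])
qed

lemma shift_1_H2: "g \<in> H2 \<Longrightarrow> shift 1 g \<in> H2"
  by (rule H2I) (simp add: cinner_shift_monomial H2D)

text \<open>Multiplying \<open>h n\<close> by \<open>z\<close> keeps it in \<open>H2\<close> and
  makes it orthogonal to \<open>z\<close> times \<open>u H2\<close>. Only its component along
  \<open>u\<close> leads out of the model space, and the coefficient \<open>c n\<close> of that
  component tends to 0 by weak nullity.\<close>

lemma almost_invariant_powi_1:
  assumes u: "inner_function u"
  shows "almost_invariant u (\<lambda>z. z powi 1)"
proof (rule almost_invariantI[OF ess_bounded_powi])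
  have ub: "ess_bounded u" and uH: "abs_L2 u \<in> H2"
    using u by (auto simp: inner_function_def)
  have u1: "mult_op u (monomial 0) = abs_L2 u"
    by (rule mult_op_monomial_0[OF ub])
  fix h assume h: "\<And>n. h n \<in> model_space u" "bounded_weakly_null h"
  define c where "c n = cinner (shift 1 (h n)) (abs_L2 u)" for n
  have mem: "shift 1 (h n) - c n *\<^sub>C abs_L2 u \<in> model_space u" for n
  proof (rule model_spaceI)
    fix m :: int assume m: "m < 0"
    show "cinner (shift 1 (h n) - c n *\<^sub>C abs_L2 u) (monomial m) = 0"
      using m H2D[OF model_spaceD(1)[OF h(1)], of "m - 1" n] H2D[OF uH m]
      by (simp add: cinner_diff_left cinner_scaleC_left cinner_shift_monomial)
  next
    fix g assume g: "g \<in> H2"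
    \<comment> \<open>Splitting off the constant term, \<open>g = a + z * g1\<close> with
      \<open>g1\<close> in \<open>H2\<close>, separates the direction of \<open>u\<close> inside
      \<open>u H2\<close> from \<open>z * u H2\<close>.\<close>
    define a where "a = cinner g (monomial 0)"
    define g1 where "g1 = shift (- 1) (g - a *\<^sub>C monomial 0)"
    have g1: "g1 \<in> H2"
    proof (rule H2I)
      fix m :: int assume "m < 0"
      then have "m = -1 \<or> m + 1 < 0" by linarith
      then show "cinner g1 (monomial m) = 0"
        using H2D[OF g]
        by (auto simp: g1_def cinner_shift_monomial cinner_diff_left
            cinner_scaleC_left cinner_monomial a_def)
    qed
    have "g = a *\<^sub>C monomial 0 + shift 1 g1"
      unfolding g1_def shift_shift_minus by simp
    then have "mult_op u g = a *\<^sub>C abs_L2 u + shift 1 (mult_op u g1)"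
      by (simp add: mult_op_add_right[OF ub] mult_op_scaleC[OF ub] u1 mult_op_shift[OF ub])
    moreover have "cinner (shift 1 (h n)) (shift 1 (mult_op u g1)) = 0"
      using model_spaceD(2)[OF h(1) g1, of n] shift_shift_minus[of "- 1"]
      by (simp add: cinner_shift)
    ultimately have "cinner (shift 1 (h n)) (mult_op u g) = cnj a * c n"
      by (simp add: cinner_add_right cinner_scaleC_right c_def)
    moreover have "cinner (abs_L2 u) (mult_op u g) = cnj a"
      unfolding u1[symmetric] cinner_mult_op_inner_function[OF u] a_def by (rule cinner_commute)
    ultimately show "cinner (shift 1 (h n) - c n *\<^sub>C abs_L2 u) (mult_op u g) = 0"
      by (simp add: cinner_diff_left cinner_scaleC_left)
  qed
  have "c \<longlonglongrightarrow> 0"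
    using h(2) unfolding c_def cinner_shift by (simp add: bounded_weakly_null_def)
  show "(\<lambda>n. orth_dist (model_orth u) (mult_op (\<lambda>z. z powi 1) (h n))) \<longlonglongrightarrow> 0"
    unfolding shift_def[symmetric]
  proof (rule tendsto_orth_dist_0)
    show "(\<lambda>n. norm (c n) * norm (abs_L2 u)) \<longlonglongrightarrow> 0"
      by (intro tendsto_mult_left_zero tendsto_norm_zero) fact
    show "orth_dist (model_orth u) (shift 1 (h n)) \<le> norm (c n) * norm (abs_L2 u)" for n
      using orth_dist_le[OF mem[of n, unfolded model_space_eq_orth], of "shift 1 (h n)"]
      by (simp add: norm_scaleC)
  qed
qed

text \<open>Dividing by \<open>z\<close> preserves orthogonality to \<open>u H2\<close>, because
  \<open>u H2\<close> is invariant under \<open>z\<close>. It leaves \<open>H2\<close> only through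
  the coefficient of degree -1, which is the constant term \<open>a n\<close> of \<open>h n\<close>;
  the monomial removed is orthogonal to \<open>u H2\<close> already.\<close>

lemma almost_invariant_powi_minus_1:
  assumes u: "inner_function u"
  shows "almost_invariant u (\<lambda>z. z powi (- 1))"
proof (rule almost_invariantI[OF ess_bounded_powi])
  have ub: "ess_bounded u" and uH: "abs_L2 u \<in> H2"
    using u by (auto simp: inner_function_def)
  fix h assume h: "\<And>n. h n \<in> model_space u" "bounded_weakly_null h"
  define a where "a n = cinner (h n) (monomial 0)" for n
  have mem: "shift (- 1) (h n) - a n *\<^sub>C monomial (- 1) \<in> model_space u" for n
  proof (rule model_spaceI)
    fix m :: int assume "m < 0"
    then have "m = -1 \<or> m + 1 < 0" by linarith
    then show "cinner (shift (- 1) (h n) - a n *\<^sub>C monomial (- 1)) (monomial m) = 0"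
      using H2D[OF model_spaceD(1)[OF h(1)], of "m + 1" n]
      by (auto simp: cinner_diff_left cinner_scaleC_left cinner_shift_monomial
          cinner_monomial a_def)
  next
    fix g assume g: "g \<in> H2"
    have "cinner (shift (- 1) (h n)) (mult_op u g) = cinner (h n) (mult_op u (shift 1 g))"
      by (simp add: cinner_shift mult_op_shift[OF ub])
    moreover have "cinner (mult_op u g) (monomial (- 1)) = 0"
      by (rule H2D[OF mult_op_H2[OF ub uH g]]) simp
    then have "cinner (monomial (- 1)) (mult_op u g) = 0"
      by (metis cinner_commute complex_cnj_zero)
    ultimately show "cinner (shift (- 1) (h n) - a n *\<^sub>C monomial (- 1)) (mult_op u g) = 0"
      using model_spaceD(2)[OF h(1) shift_1_H2[OF g]]
      by (simp add: cinner_diff_left cinner_scaleC_left)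
  qed
  have "a \<longlonglongrightarrow> 0"
    using h(2) unfolding a_def by (simp add: bounded_weakly_null_def)
  show "(\<lambda>n. orth_dist (model_orth u) (mult_op (\<lambda>z. z powi (- 1)) (h n))) \<longlonglongrightarrow> 0"
    unfolding shift_def[symmetric]
  proof (rule tendsto_orth_dist_0)
    show "(\<lambda>n. norm (a n) * norm (monomial (- 1))) \<longlonglongrightarrow> 0"
      by (intro tendsto_mult_left_zero tendsto_norm_zero) fact
    show "orth_dist (model_orth u) (shift (- 1) (h n)) \<le> norm (a n) * norm (monomial (- 1))" for n
      using orth_dist_le[OF mem[of n, unfolded model_space_eq_orth], of "shift (- 1) (h n)"]
      by (simp add: norm_scaleC)
  qed
qed

text \<open>The two preceding results supply the generators \<open>z\<close> and
  \<open>cnj z\<close>. A uniform limit is handled by splitting \<open>f = (f - g) + g\<close>: the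
  first part costs at most \<open>d * B\<close>, the second tends to 0.\<close>

lemma almost_invariant_continuous:
  assumes u: "inner_function u" and "continuous_on (sphere 0 1) \<phi>"
  shows "almost_invariant u \<phi>"
  using assms(2)
proof (rule circle_continuous_induct)
  show "almost_invariant u (\<lambda>z. z)"
    using almost_invariant_powi_1[OF u] by simp
  have "ess_bounded cnj"
    by (intro ess_bounded_continuous continuous_intros)
  moreover from this have "mult_op cnj f = mult_op (\<lambda>z. z powi (- 1)) f" for f
    by (intro mult_op_cong ess_bounded_powi AE_circI) (simp_all add: circ_cnj)
  ultimately show "almost_invariant u cnj"
    using almost_invariant_powi_minus_1[OF u] by (simp add: almost_invariant_def)
next
  fix f :: "complex \<Rightarrow> complex"
  assume f: "continuous_on (sphere 0 1) f"
  assume approx: "\<And>e. e > 0 \<Longrightarrow> \<exists>g. continuous_on (sphere 0 1) g \<and> almost_invariant u g \<and>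
      (\<forall>z\<in>sphere 0 1. norm (f z - g z) < e)"
  show "almost_invariant u f"
  proof (rule almost_invariantI[OF ess_bounded_continuous[OF f]])
    let ?d = "orth_dist (model_orth u)"
    fix h assume h: "\<And>n. h n \<in> model_space u" "bounded_weakly_null h"
    obtain B where B: "\<And>n. norm (h n) \<le> B"
      using h(2) by (auto simp: bounded_weakly_null_def)
    have B0: "0 \<le> B"
      using order_trans[OF norm_ge_zero B] .
    show "(\<lambda>n. ?d (mult_op f (h n))) \<longlonglongrightarrow> 0"
    proof (rule LIMSEQ_I)
      fix e :: real assume e: "e > 0"
      \<comment> \<open>Each part gets \<open>e / 2\<close>; using \<open>B + 1\<close> keeps the
        denominator positive when \<open>B = 0\<close>.\<close>
      define d where "d = e / (2 * (B + 1))"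
      have d: "d > 0"
        using e B0 by (simp add: d_def)
      then obtain g where g: "continuous_on (sphere 0 1) g" "almost_invariant u g"
          "\<And>z. z \<in> sphere 0 1 \<Longrightarrow> norm (f z - g z) < d"
        using approx by blast
      have fg: "continuous_on (sphere 0 1) (\<lambda>z. f z - g z)"
        by (intro continuous_intros f g)
      obtain N where N: "\<And>n. n \<ge> N \<Longrightarrow> ?d (mult_op g (h n)) < e / 2"
        using LIMSEQ_D[OF almost_invariantD[OF g(2) h], of "e / 2"] e by (auto simp: orth_dist_nonneg)
      have "norm (?d (mult_op f (h n)) - 0) < e" if "n \<ge> N" for n
      proof -
        have "mult_op f (h n) = mult_op (\<lambda>z. f z - g z) (h n) + mult_op g (h n)"
          using mult_op_add[OF ess_bounded_continuous[OF fg] ess_bounded_continuous[OF g(1)], of "h n"]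
          by simp
        then have "?d (mult_op f (h n)) \<le> ?d (mult_op (\<lambda>z. f z - g z) (h n)) + ?d (mult_op g (h n))"
          by (simp add: orth_dist_add)
        also have "?d (mult_op (\<lambda>z. f z - g z) (h n)) \<le> norm (mult_op (\<lambda>z. f z - g z) (h n))"
          by (rule orth_dist_le_norm)
        also have "\<dots> \<le> d * norm (h n)"
          by (intro norm_mult_op_le ess_bounded_continuous fg AE_circI)
             (use d g(3) in \<open>auto intro: less_imp_le\<close>)
        also have "\<dots> \<le> d * B"
          using d B by (intro mult_left_mono) auto
        also have "\<dots> \<le> d * (B + 1)"
          using d by simp
        also have "\<dots> = e / 2"
          using B0 by (simp add: d_def field_simps)
        finally show ?thesis
          using N[OF that] by (simp add: orth_dist_nonneg)
      qed
      then show "\<exists>N. \<forall>n\<ge>N. norm (?d (mult_op f (h n)) - 0) < e"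
        by blast
    qed
  qed
qed (simp_all add: almost_invariant_const almost_invariant_add almost_invariant_mult)

subsection \<open>Direct sums\<close>

lemma cadjoint_eqI:
  assumes "\<And>x y. cinner (A x) y = cinner x (B y)"
  shows "cadjoint A = B"
  unfolding cadjoint_def
proof (rule the_equality)
  fix C assume C: "\<forall>x y. cinner (A x) y = cinner x (C y)"
  show "C = B"
  proof (rule ext, rule cinner_eqI_right)
    show "cinner x (C y) = cinner x (B y)" for x y
      using C[rule_format, of x y] assms[of x y] by simp
  qed
qed (simp add: assms)

text \<open>The common bound 1 on all summands makes the componentwise image square summable, so
  that \<open>Abs_l2_sum\<close> in \<open>direct_sum\<close> yields the intended vector.\<close>

definition contractive :: "('a::real_normed_vector \<Rightarrow> 'b::real_normed_vector) \<Rightarrow> bool" where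
  "contractive A \<longleftrightarrow> (\<forall>x. norm (A x) \<le> norm x)"

lemma component_direct_sum:
  assumes "\<And>i. contractive (A i)"
  shows "component (direct_sum A x) i = A i (component x i)"
proof -
  have "summable (\<lambda>i. (norm (A i (component x i)))\<^sup>2)"
    by (rule summable_comparison_test'[OF summable_component[of x]])
       (use assms in \<open>auto simp: contractive_def intro!: power_mono\<close>)
  then show ?thesis
    by (simp add: direct_sum_def Abs_l2_sum_inverse)
qed

lemma l2_sum_eqI: "(\<And>i. component x i = component y i) \<Longrightarrow> x = y"
  by (simp add: component_inject[symmetric] fun_eq_iff)

lemma contractive_direct_sum:
  fixes A :: "nat \<Rightarrow> 'a::real_inner \<Rightarrow> 'a"
  assumes "\<And>i. contractive (A i)"
  shows "contractive (direct_sum A)"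
  unfolding contractive_def
proof
  fix x
  have "(norm (direct_sum A x))\<^sup>2 \<le> (norm x)\<^sup>2"
    unfolding norm_sq_l2_sum
  proof (rule suminf_le)
    show "(norm (component (direct_sum A x) i))\<^sup>2 \<le> (norm (component x i))\<^sup>2" for i
      using assms by (simp add: component_direct_sum contractive_def power_mono)
  qed (rule summable_component)+
  then show "norm (direct_sum A x) \<le> norm x"
    by (rule power2_le_imp_le) simp
qed

lemma clinear_direct_sum:
  fixes A :: "nat \<Rightarrow> 'a::complex_inner \<Rightarrow> 'a"
  assumes "\<And>i. contractive (A i)" "\<And>i. clinear (A i)"
  shows "clinear (direct_sum A)"
  using assms(2) unfolding clinear_def
  by (auto intro!: l2_sum_eqI simp: component_direct_sum[OF assms(1)] plus_l2_sum.rep_eq scaleC_l2_sum.rep_eq)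

lemma conj_linear_direct_sum:
  fixes A :: "nat \<Rightarrow> 'a::complex_inner \<Rightarrow> 'a"
  assumes "\<And>i. contractive (A i)" "\<And>i. conj_linear (A i)"
  shows "conj_linear (direct_sum A)"
  using assms(2) unfolding conj_linear_def
  by (auto intro!: l2_sum_eqI simp: component_direct_sum[OF assms(1)] plus_l2_sum.rep_eq scaleC_l2_sum.rep_eq)

lemma cinner_direct_sum:
  assumes "\<And>i. contractive (A i)" "\<And>i. contractive (B i)"
    and "\<And>i x y. cinner (A i x) y = cinner x (B i y)"
  shows "cinner (direct_sum A x) y = cinner x (direct_sum B y)"
  by (simp add: cinner_l2_sum_def component_direct_sum assms)

lemma conjugation_direct_sum:
  fixes A :: "nat \<Rightarrow> 'a::chilbert_space \<Rightarrow> 'a"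
  assumes "\<And>i. conjugation (A i)"
  shows "conjugation (direct_sum A)"
proof -
  have contr: "contractive (A i)" for i
    using assms by (simp add: conjugation_def contractive_def)
  have "(norm (direct_sum A x))\<^sup>2 = (norm x)\<^sup>2" for x
    using assms unfolding norm_sq_l2_sum by (simp add: component_direct_sum[OF contr] conjugation_def)
  then have "norm (direct_sum A x) = norm x" for x
    by simp
  then show ?thesis
    using assms unfolding conjugation_def
    by (auto intro!: conj_linear_direct_sum contr l2_sum_eqI simp: component_direct_sum[OF contr])
qed

section \<open>Vectors supported in one summand\<close>

lift_definition single_l2 :: "nat \<Rightarrow> 'a::real_normed_vector \<Rightarrow> 'a l2_sum" is
  "\<lambda>n x i. if i = n then x else 0"
  by (rule summable_finite[of "{n}" for n]) auto

lemma cinner_single_l2: "cinner x (single_l2 n y) = cinner (component x n) y"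
proof -
  have "cinner x (single_l2 n y) = (\<Sum>i\<in>{n}. cinner (component x i) (component (single_l2 n y) i))"
    unfolding cinner_l2_sum_def by (rule suminf_finite) (auto simp: single_l2.rep_eq)
  then show ?thesis
    by (simp add: single_l2.rep_eq)
qed

lemma norm_single_l2: "norm (single_l2 n y) = norm y" for y :: "'a::complex_inner"
proof -
  have "cinner (single_l2 n y) (single_l2 n y) = cinner y y"
    by (simp add: cinner_single_l2 single_l2.rep_eq)
  then show ?thesis
    by (simp add: cinner_self of_real_eq_iff del: of_real_power)
qed

text \<open>Testing against \<open>x\<close> sees only the component of \<open>x\<close> in summand
  \<open>n\<close>, and the components of a square summable family tend to 0.\<close>

lemma bounded_weakly_null_single_l2: "bounded_weakly_null (\<lambda>n. single_l2 n y)"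
  unfolding bounded_weakly_null_def
proof (intro conjI allI)
  show "\<exists>B. \<forall>n. norm (single_l2 n y) \<le> B"
    by (auto simp: norm_single_l2)
  fix x :: "'a l2_sum"
  have "(\<lambda>n. (norm (component x n))\<^sup>2) \<longlonglongrightarrow> 0"
    by (rule summable_LIMSEQ_zero[OF summable_component])
  then have "(\<lambda>n. sqrt ((norm (component x n))\<^sup>2)) \<longlonglongrightarrow> sqrt 0"
    by (rule tendsto_real_sqrt)
  then have lim: "(\<lambda>n. norm y * norm (component x n)) \<longlonglongrightarrow> 0"
    by (intro tendsto_mult_right_zero) simp
  show "(\<lambda>n. cinner (single_l2 n y) x) \<longlonglongrightarrow> 0"
  proof (rule Lim_null_comparison[OF always_eventually lim], rule allI)
    fix n
    have "norm (cinner (single_l2 n y) x) = norm (cinner (component x n) y)"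
      by (metis cinner_commute cinner_single_l2 complex_mod_cnj)
    then show "norm (cinner (single_l2 n y) x) \<le> norm y * norm (component x n)"
      using norm_cinner_le_mult[of "component x n" y] by (simp add: mult.commute)
  qed
qed

subsection \<open>The shift and its adjoint\<close>

lift_definition backward_shift :: "ell2 \<Rightarrow> ell2" is "\<lambda>x i. x (Suc i)"
  by (subst summable_Suc_iff)

lift_definition ell2_cnj :: "ell2 \<Rightarrow> ell2" is "\<lambda>x i. cnj (x i)"
  by simp

lemma norm_unilateral_shift: "norm (unilateral_shift x) = norm x"
proof -
  have "(norm (unilateral_shift x))\<^sup>2 = (norm x)\<^sup>2"
    unfolding norm_sq_l2_sum
    using suminf_split_head[OF summable_component[of "unilateral_shift x"]]
    by (simp add: unilateral_shift.rep_eq)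
  then show ?thesis by simp
qed

lemma cinner_unilateral_shift: "cinner (unilateral_shift x) y = cinner x (backward_shift y)"
  unfolding cinner_l2_sum_def
  using suminf_split_head[OF summable_cinner_component[of "unilateral_shift x" y]]
  by (simp add: unilateral_shift.rep_eq backward_shift.rep_eq)

lemma cadjoint_unilateral_shift: "cadjoint unilateral_shift = backward_shift"
  by (intro cadjoint_eqI cinner_unilateral_shift)

lemma norm_backward_shift_le: "norm (backward_shift x) \<le> norm x"
proof -
  have "(norm (backward_shift x))\<^sup>2 \<le> (norm x)\<^sup>2"
    unfolding norm_sq_l2_sum
    using suminf_split_head[OF summable_component[of x]] by (simp add: backward_shift.rep_eq)
  then show ?thesis
    by (rule power2_le_imp_le) simp
qed

lemma clinear_unilateral_shift: "clinear unilateral_shift"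
  unfolding clinear_def
  by (auto intro!: l2_sum_eqI simp: unilateral_shift.rep_eq plus_l2_sum.rep_eq scaleC_l2_sum.rep_eq
      scaleC_complex_def split: nat.split)

lemma clinear_backward_shift: "clinear backward_shift"
  unfolding clinear_def
  by (auto intro!: l2_sum_eqI simp: backward_shift.rep_eq plus_l2_sum.rep_eq scaleC_l2_sum.rep_eq)

lemma conjugation_ell2_cnj: "conjugation ell2_cnj"
proof -
  have "(norm (ell2_cnj x))\<^sup>2 = (norm x)\<^sup>2" for x
    unfolding norm_sq_l2_sum by (simp add: ell2_cnj.rep_eq)
  then have "norm (ell2_cnj x) = norm x" for x
    by simp
  then show ?thesis
    unfolding conjugation_def conj_linear_def
    by (auto intro!: l2_sum_eqI simp: ell2_cnj.rep_eq plus_l2_sum.rep_eq scaleC_l2_sum.rep_eq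
        scaleC_complex_def)
qed

text \<open>The shift has a real matrix in the standard basis, so it commutes with coordinatewise
  conjugation.\<close>

lemma ell2_cnj_unilateral_shift: "ell2_cnj (unilateral_shift (ell2_cnj x)) = unilateral_shift x"
  by (auto intro!: l2_sum_eqI simp: ell2_cnj.rep_eq unilateral_shift.rep_eq split: nat.split)

lemma ell2_cnj_backward_shift: "ell2_cnj (backward_shift (ell2_cnj x)) = backward_shift x"
  by (auto intro!: l2_sum_eqI simp: ell2_cnj.rep_eq backward_shift.rep_eq)

lemma contractive_map_prod:
  "contractive A \<Longrightarrow> contractive B \<Longrightarrow> contractive (map_prod A B)"
  by (auto simp: contractive_def norm_prod_def intro!: real_sqrt_le_mono add_mono power_mono)

lemma clinear_map_prod: "clinear A \<Longrightarrow> clinear B \<Longrightarrow> clinear (map_prod A B)"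
  by (auto simp: clinear_def scaleC_prod_def)

text \<open>Exchanging the coordinates is what turns the adjoint of the pair (shift, backward
  shift), in which the two operators trade places, back into the pair itself.\<close>

lemma conjugation_swap:
  assumes "conjugation J"
  shows "conjugation (\<lambda>p. (J (snd p), J (fst p)))"
  using assms by (auto simp: conjugation_def conj_linear_def scaleC_prod_def norm_prod_def add.commute)

section \<open>Complex symmetry of the direct sum\<close>

theorem complex_symmetric_shift_sum:
  "complex_symmetric (direct_sum (\<lambda>i. map_prod unilateral_shift (cadjoint unilateral_shift)))"
proof -
  let ?A = "\<lambda>i :: nat. map_prod unilateral_shift backward_shift"
  let ?B = "\<lambda>i :: nat. map_prod backward_shift unilateral_shift"
  let ?J = "\<lambda>i :: nat. \<lambda>p :: ell2 \<times> ell2. (ell2_cnj (snd p), ell2_cnj (fst p))"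
  have shift: "contractive unilateral_shift" "contractive backward_shift"
    by (simp_all add: contractive_def norm_unilateral_shift norm_backward_shift_le)
  then have A: "contractive (?A i)" and B: "contractive (?B i)" for i
    by (auto intro: contractive_map_prod)
  have J: "conjugation (?J i)" for i
    by (rule conjugation_swap[OF conjugation_ell2_cnj])
  then have Jc: "contractive (?J i)" for i
    by (auto simp: conjugation_def contractive_def)
  \<comment> \<open>The adjoint is taken summand by summand, and the adjoint of the backward shift
    is the shift again.\<close>
  have adj: "cadjoint (direct_sum ?A) = direct_sum ?B"
  proof (intro cadjoint_eqI cinner_direct_sum A B)
    fix x y :: "ell2 \<times> ell2"
    have "cinner (backward_shift a) b = cinner a (unilateral_shift b)" for a b
      by (metis cinner_commute cinner_unilateral_shift)
    then show "cinner (?A i x) y = cinner x (?B i y)" for i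
      by (simp add: cinner_prod_def cinner_unilateral_shift)
  qed
  have "bounded_clinear (direct_sum ?A)"
    unfolding bounded_clinear_def
  proof
    show "clinear (direct_sum ?A)"
      by (intro clinear_direct_sum A clinear_map_prod clinear_unilateral_shift clinear_backward_shift)
    show "\<exists>K. \<forall>x. norm (direct_sum ?A x) \<le> K * norm x"
      using contractive_direct_sum[of ?A, OF A] by (intro exI[of _ 1]) (simp add: contractive_def)
  qed
  moreover have "direct_sum ?A = direct_sum ?J \<circ> direct_sum ?B \<circ> direct_sum ?J"
    by (auto intro!: ext l2_sum_eqI simp: component_direct_sum[of ?A, OF A] component_direct_sum[of ?B, OF B]
        component_direct_sum[of ?J, OF Jc] ell2_cnj_unilateral_shift ell2_cnj_backward_shift prod_eq_iff)
  ultimately show ?thesis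
    unfolding complex_symmetric_def cadjoint_unilateral_shift adj
    using conjugation_direct_sum[of ?J, OF J] by blast
qed

section \<open>Failure of unitary equivalence\<close>

theorem shift_sum_not_truncated_toeplitz:
  assumes u: "inner_function u" and \<phi>: "continuous_on (sphere 0 1) \<phi>"
  shows "\<not> unitarily_equivalent_on
    (direct_sum (\<lambda>i. map_prod unilateral_shift (cadjoint unilateral_shift)))
    (model_space u) (truncated_toeplitz u \<phi>)"
proof
  define T :: "(ell2 \<times> ell2) l2_sum \<Rightarrow> _" where
    "T = direct_sum (\<lambda>i. map_prod unilateral_shift backward_shift)"
  assume "unitarily_equivalent_on
    (direct_sum (\<lambda>i. map_prod unilateral_shift (cadjoint unilateral_shift)))
    (model_space u) (truncated_toeplitz u \<phi>)"
  then obtain U where isom: "\<And>x y. cinner (U x) (U y) = cinner x y"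
    and range: "range U = model_space u" and lin: "clinear U"
    and UT: "\<And>x. U (T x) = truncated_toeplitz u \<phi> (U x)"
    unfolding unitarily_equivalent_on_def T_def cadjoint_unilateral_shift by blast
  have contr: "contractive (map_prod unilateral_shift backward_shift)"
    by (intro contractive_map_prod)
       (simp_all add: contractive_def norm_unilateral_shift norm_backward_shift_le)
  define \<delta> :: "nat \<Rightarrow> ell2" where "\<delta> k = single_l2 k 1" for k
  have S0: "unilateral_shift 0 = 0" and B0: "backward_shift 0 = 0" and
    B\<delta>0: "backward_shift (\<delta> 0) = 0" and B\<delta>1: "backward_shift (\<delta> 1) = \<delta> 0"
    by (auto intro!: l2_sum_eqI simp: \<delta>_def unilateral_shift.rep_eq backward_shift.rep_eq
        single_l2.rep_eq zero_l2_sum.rep_eq split: nat.split)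
  \<comment> \<open>Both vectors sit in the backward-shift half of summand \<open>n\<close>, where
    that shift sends the basis vector \<open>\<delta> 1\<close> to \<open>\<delta> 0\<close> and
    \<open>\<delta> 0\<close> to 0.\<close>
  define e g where "e n = single_l2 n (0 :: ell2, \<delta> 0)" and "g n = single_l2 n (0 :: ell2, \<delta> 1)" for n
  have Te: "T (e n) = 0" and Tg: "T (g n) = e n" for n
    by (auto intro!: l2_sum_eqI simp: T_def component_direct_sum[OF contr] e_def g_def
        single_l2.rep_eq zero_l2_sum.rep_eq S0 B0 B\<delta>0 B\<delta>1[unfolded One_nat_def] zero_prod_def)
  have norm_e: "norm (e n) = 1" and norm_g: "norm (g n) = 1" for n
    by (simp_all add: e_def g_def norm_single_l2 \<delta>_def norm_prod_def)
  have norm_U: "norm (U x) = norm x" for x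
    using isom[of x x] by (simp add: cinner_self of_real_eq_iff del: of_real_power)
  have mem: "U x \<in> model_space u" for x
    using range by blast
  have null: "bounded_weakly_null (\<lambda>n. U (e n))"
    unfolding bounded_weakly_null_def
  proof (intro conjI allI)
    show "\<exists>B. \<forall>n. norm (U (e n)) \<le> B"
      by (auto simp: norm_U norm_e)
    fix x
    \<comment> \<open>Weak nullity has to be tested against all of \<open>L2\<close>. Since
      \<open>U (e n)\<close> lies in the model space, \<open>x\<close> may be replaced by its
      projection, which is in the range of \<open>U\<close>.\<close>
    obtain y where y: "orth_proj (model_space u) x = U y"
      using range orth_proj_in[of "model_orth u" x] unfolding model_space_eq_orth by blast
    have "cinner (U (e n)) x = cinner (e n) y" for n
    proof -
      have "cinner (U (e n)) x = cinner (orth_proj (model_space u) (U (e n))) x"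
        using orth_proj_equality[of "U (e n)" "model_orth u" "U (e n)"] mem[of "e n"]
        by (simp add: model_space_eq_orth)
      also have "\<dots> = cinner (U (e n)) (U y)"
        unfolding y[symmetric] model_space_eq_orth by (rule cinner_orth_proj_left)
      finally show ?thesis
        by (simp add: isom)
    qed
    then show "(\<lambda>n. cinner (U (e n)) x) \<longlonglongrightarrow> 0"
      using bounded_weakly_null_single_l2[of "(0 :: ell2, \<delta> 0)"] by (simp add: bounded_weakly_null_def e_def)
  qed
  have bdd: "ess_bounded \<phi>"
    by (rule ess_bounded_continuous[OF \<phi>])
  have U0: "U 0 = 0"
    using norm_U[of 0] by simp
  \<comment> \<open>As the compression kills \<open>U (e n)\<close>, its \<open>orth_dist\<close>
    after multiplication by \<phi> is the whole norm.\<close>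
  have "orth_proj (orth (model_orth u)) (mult_op \<phi> (U (e n))) = 0" for n
    using UT[of "e n"] by (simp add: Te U0 truncated_toeplitz_def model_space_eq_orth)
  then have "(\<lambda>n. norm (mult_op \<phi> (U (e n)))) \<longlonglongrightarrow> 0"
    using almost_invariantD[OF almost_invariant_continuous[OF u \<phi>] mem null]
    by (simp add: orth_dist_def)
  \<comment> \<open>Since \<open>e n = T (g n)\<close>, the number 1 is an inner product of \<phi>
    times \<open>U (g n)\<close> with \<open>U (e n)\<close>. Moving the symbol to the second vector
    and using normality bounds the norm from below.\<close>
  moreover have "1 \<le> norm (mult_op \<phi> (U (e n)))" for n
  proof -
    have "1 = cinner (U (T (g n))) (U (e n))"
      unfolding Tg isom by (simp add: cinner_self norm_e)
    also have "\<dots> = cinner (mult_op \<phi> (U (g n))) (U (e n))"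
      unfolding UT truncated_toeplitz_def model_space_eq_orth
      by (rule cinner_orth_proj_in) (simp add: mem model_space_eq_orth[symmetric])
    also have "\<dots> = cinner (U (g n)) (mult_op (\<lambda>z. cnj (\<phi> z)) (U (e n)))"
      by (rule cinner_mult_op[OF bdd])
    finally have "1 \<le> norm (U (g n)) * norm (mult_op (\<lambda>z. cnj (\<phi> z)) (U (e n)))"
      using norm_cinner_le_mult by (metis norm_one)
    then show ?thesis
      by (simp add: norm_U norm_g norm_mult_op_cnj[OF bdd])
  qed
  ultimately show False
    using LIMSEQ_le_const[of _ 0 1] by fastforce
qed

theorem corollary3:
  fixes T :: "(ell2 \<times> ell2) l2_sum \<Rightarrow> (ell2 \<times> ell2) l2_sum"
  defines "T \<equiv> direct_sum (\<lambda>i. map_prod unilateral_shift (cadjoint unilateral_shift))"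
  shows "complex_symmetric T \<and>
         \<not> (\<exists>u \<phi>. inner_function u \<and> nonconstant u \<and> continuous_on (sphere 0 1) \<phi> \<and>
                  unitarily_equivalent_on T (model_space u) (truncated_toeplitz u \<phi>))"
  unfolding T_def using complex_symmetric_shift_sum shift_sum_not_truncated_toeplitz by blast

end
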